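(* Let $\varepsilon>0$ be any constant, and let $p=p(n)$ satisfy $$\frac{(\log n)^{2+\varepsilon}}{n}\le p = O\big((\log\log n)^{1/3}(\log n)^2 n^{-1/3}\big).$$ Let $G\in\mathcal{G}(n,p)$. Then, a.a.s., $$\chi_P(G)=\Theta\left(\frac{np}{\log(np)}\right)=\Theta(\chi(G)).$$ Moreover, if $np=(\log n)^{C+o(1)}$ (where $C$ may depend on $n$), then a.a.s. $$\chi(G)\le \chi_P(G)\le (1+o(1))\begin{cases} 2\chi(G) & \text{if } C\to\infty,\\ \frac{2C}{C-2}\chi(G) & \text{if } C\in[4,\infty),\\ 4\chi(G) & \text{if } C\in(2,4).\end{cases}$$
   Context: $\mathcal{G}(n,p)$ is the binomial random graph on vertex set $\{1,\dots,n\}$ in which each of the $\binom n2$ pairs is an edge independently with probability $p$. An event holds asymptotically almost surely (a.a.s.) if its probability tends to $1$ as $n\to\infty$. Asymptotic notation is as $n\to\infty$; logarithms are natural. $\chi(G)$ is the chromatic number. $\chi_P(G)$, the paintability (on-line choice number), is defined via the following game between Mr. Paint and Mrs. Correct on $G$, where each vertex initially has the same number of erasers: in each round Mr. Paint selects a subset of the (remaining) vertices and paints them with a new colour (never used before); Mrs. Correct then erases the colour from some of these vertices so that no two adjacent vertices keep the same colour, each erasure at a vertex using up one eraser at that vertex (she cannot erase at a vertex with no erasers left). Vertices whose colour is not erased are permanently coloured and removed. Mrs. Correct wins if all vertices become permanently coloured; Mr. Paint wins if at some point he presents two adjacent vertices neither of which has any eraser left. $G$ is $k$-paintable if Mrs.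 Correct has a winning strategy when each vertex initially has $k-1$ erasers; $\chi_P(G)$ is the least such $k$. *)

theory Defs
  imports "HOL-Probability.Probability" "HOL-Library.Landau_Symbols"
begin

text \<open>A simple graph is a pair of a vertex set and a set of edges, an edge being a
  two-element set of vertices.\<close>

type_synonym 'a graph = "'a set \<times> 'a set set"

definition independent_set :: "'a set set \<Rightarrow> 'a set \<Rightarrow> bool" where
  "independent_set E S \<longleftrightarrow> (\<forall>u\<in>S. \<forall>v\<in>S. {u, v} \<notin> E)"

definition colourable :: "'a graph \<Rightarrow> nat \<Rightarrow> bool" where
  "colourable G k \<longleftrightarrow>
     (\<exists>c. c \<in> fst G \<rightarrow> {..<k} \<and> (\<forall>u\<in>fst G. \<forall>v\<in>fst G. {u, v} \<in> snd G \<longrightarrow> c u \<noteq> c v))"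

definition chromatic_number :: "'a graph \<Rightarrow> nat" where
  "chromatic_number G = (LEAST k. colourable G k)"

text \<open>\<open>correct_wins E U r\<close>: Mrs. Correct can force a win from the position in which \<open>U\<close> is the
  set of vertices not yet permanently coloured and \<open>r v\<close> is the number of erasers left at \<open>v\<close>.
  Mr. Paint presents \<open>S\<close>, Mrs. Correct erases the colour at \<open>R\<close>, and \<open>S - R\<close> is removed.
  The position \<open>U = {}\<close> is won by Mrs. Correct because Mr. Paint has no move there. She has
  no legal answer \<open>R\<close> exactly when \<open>S\<close> contains two adjacent vertices without erasers, which is
  the winning condition of Mr. Paint. Mr. Paint has to present at least one vertex, since
  otherwise he could prolong the game forever; as a nonempty \<open>S\<close> either removes a vertex or uses
  up an eraser, every play on a finite graph is then finite.\<close>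

inductive correct_wins :: "'a set set \<Rightarrow> 'a set \<Rightarrow> ('a \<Rightarrow> nat) \<Rightarrow> bool" for E where
  "(\<And>S. S \<subseteq> U \<Longrightarrow> S \<noteq> {} \<Longrightarrow>
      \<exists>R\<subseteq>S. (\<forall>v\<in>R. 0 < r v) \<and> independent_set E (S - R) \<and>
        correct_wins E (U - (S - R)) (\<lambda>v. if v \<in> R then r v - 1 else r v))
   \<Longrightarrow> correct_wins E U r"

definition paintable :: "'a graph \<Rightarrow> nat \<Rightarrow> bool" where
  "paintable G k \<longleftrightarrow> 1 \<le> k \<and> correct_wins (snd G) (fst G) (\<lambda>_. k - 1)"

definition paintability :: "'a graph \<Rightarrow> nat" where
  "paintability G = (LEAST k. paintable G k)"

definition vertex_pairs :: "nat \<Rightarrow> nat set set" where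
  "vertex_pairs n = {e. e \<subseteq> {1..n} \<and> card e = 2}"

definition gnp :: "nat \<Rightarrow> real \<Rightarrow> nat graph pmf" where
  "gnp n p = map_pmf (\<lambda>X. ({1..n}, {e \<in> vertex_pairs n. X e}))
               (Pi_pmf (vertex_pairs n) False (\<lambda>_. bernoulli_pmf p))"

definition aas :: "(nat \<Rightarrow> real) \<Rightarrow> (nat \<Rightarrow> nat graph \<Rightarrow> bool) \<Rightarrow> bool" where
  "aas p P \<longleftrightarrow> (\<lambda>n. measure_pmf.prob (gnp n (p n)) {G. P n G}) \<longlonglongrightarrow> 1"

text \<open>\<open>X = \<Theta>(Y)\<close> a.a.s. and \<open>X \<le> (1 + o(1)) Y\<close> a.a.s.; the implied constants and the
  \<open>o(1)\<close> term are deterministic.\<close>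

definition aas_theta ::
    "(nat \<Rightarrow> real) \<Rightarrow> (nat \<Rightarrow> nat graph \<Rightarrow> real) \<Rightarrow> (nat \<Rightarrow> nat graph \<Rightarrow> real) \<Rightarrow> bool" where
  "aas_theta p X Y \<longleftrightarrow>
     (\<exists>a>0. \<exists>b>0. aas p (\<lambda>n G. a * Y n G \<le> X n G \<and> X n G \<le> b * Y n G))"

definition aas_asymp_le ::
    "(nat \<Rightarrow> real) \<Rightarrow> (nat \<Rightarrow> nat graph \<Rightarrow> real) \<Rightarrow> (nat \<Rightarrow> nat graph \<Rightarrow> real) \<Rightarrow> bool" where
  "aas_asymp_le p X Y \<longleftrightarrow>
     (\<exists>\<eta>. \<eta> \<longlonglongrightarrow> 0 \<and> aas p (\<lambda>n G. X n G \<le> (1 + \<eta> n) * Y n G))"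

end

theory Submission
  imports Defs "HOL-Real_Asymp.Real_Asymp"
begin

text \<open>For the upper bound on the paintability, Mrs. Correct treats presented sets of at least
  \<open>n / (ln n * (ln (np))^2)\<close> vertices differently from smaller ones. A.a.s. every large set contains an
  independent set of size \<open>k = (1 - o(1)) (ln (np) - ln (ln n)) / p\<close>: otherwise about \<open>s / k\<close> successive
  greedy attempts on disjoint parts of some set of size \<open>s\<close> would all fail, which is unlikely enough for
  a union bound. Keeping such an independent set costs each vertex at most \<open>n / k\<close> erasers in total.
  Small sets induce sparse, hence \<open>d\<close>-colourable, subgraphs. There she keeps the heaviest colour class
  with respect to weights that grow by the factor \<open>d / (d - 1)\<close> per erasure; the total weight does not
  increase, so this costs each vertex at most \<open>d * ln n = o(np / ln (np))\<close> erasers, by \<open>np \<ge> (ln n)^(2 + \<epsilon>)\<close>.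
  For the lower bound, the independence number is a.a.s. at most \<open>(2 + o(1)) ln (np) / p\<close>, and the
  paintability is at least the chromatic number because Mr. Paint may always present all vertices.\<close>

section \<open>The painting game\<close>

text \<open>Mr. Paint chooses his sets adaptively, so all sets of the critical size s must contain
  the independent set at once. A union bound over about (e * n / s) ^ s sets, with n / s at most ln
  n * (ln (np))^2, calls for a failure probability of the form exp (- c * s * ln (np)). The bound
  exp (- \<theta> * k) for one greedy run is far too weak, since k is much smaller than s. But a
  failed run has exposed only edges at the fewer than k vertices that it chose, and the pairs among
  all other vertices are still fresh. Hence about s / (2 * k) runs give exp (- \<theta> * s / 2),
  and \<theta> of order (ln (np))^2 beats the union bound. The cut-off s is a compromise. Sets below
  it are coloured with d of order s * p + ln n colours, and s * p * ln n is about np / (ln (np))^2,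
  smaller than np / ln (np) by a factor ln (np). Sets above it lose ln (ln n) in the greedy size ln
  (s * p) / p, and this loss is what separates the upper bound from twice the chromatic
  number.\<close>

lemma chromatic_number_le: "colourable G k \<Longrightarrow> chromatic_number G \<le> k"
  unfolding chromatic_number_def by (rule Least_le)

lemma paintability_le: "paintable G k \<Longrightarrow> paintability G \<le> k"
  unfolding paintability_def by (rule Least_le)

text \<open>The colour classes are the sets kept in successive rounds when Mr. Paint presents
  everything that is left. Each round costs every remaining vertex an eraser, so at most j + 1
  rounds occur.\<close>

lemma colourable_if_correct_wins:
  assumes "correct_wins E U r" "\<And>v. v \<in> U \<Longrightarrow> r v \<le> j"
  shows "colourable (U, E) (Suc j)"
  using assms
proof (induction j arbitrary: U r)
  case 0
  have "independent_set E U"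
  proof (cases "U = {}")
    case False
    from 0(1) obtain R where "R \<subseteq> U" "\<forall>v\<in>R. 0 < r v" "independent_set E (U - R)"
      using False by (cases rule: correct_wins.cases) blast
    with 0(2) have "R = {}" by force
    with \<open>independent_set E (U - R)\<close> show ?thesis by simp
  qed (simp add: independent_set_def)
  thus ?case by (auto simp: colourable_def independent_set_def intro!: exI[of _ "\<lambda>_. 0"])
next
  case (Suc j)
  show ?case
  proof (cases "U = {}")
    case True
    thus ?thesis by (auto simp: colourable_def)
  next
    case False
    from Suc.prems(1) obtain R where R: "R \<subseteq> U" "\<forall>v\<in>R. 0 < r v" "independent_set E (U - R)"
        "correct_wins E (U - (U - R)) (\<lambda>v. if v \<in> R then r v - 1 else r v)"
      using False by (cases rule: correct_wins.cases) blast
    have "U - (U - R) = R" using R(1) by blast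
    with R(4) have "colourable (R, E) (Suc j)"
      using Suc.prems(2) R(1) by (intro Suc.IH) fastforce+
    then obtain c where c: "c \<in> R \<rightarrow> {..<Suc j}" "\<And>u v. u \<in> R \<Longrightarrow> v \<in> R \<Longrightarrow> {u, v} \<in> E \<Longrightarrow> c u \<noteq> c v"
      by (auto simp: colourable_def)
    have less: "c v < Suc j" if "v \<in> R" for v using c(1) that by auto
    hence neq: "c v \<noteq> Suc j" if "v \<in> R" for v using that by fastforce
    show ?thesis
      unfolding colourable_def fst_conv snd_conv
    proof (intro exI[of _ "\<lambda>v. if v \<in> R then c v else Suc j"] conjI ballI impI)
      show "(\<lambda>v. if v \<in> R then c v else Suc j) \<in> U \<rightarrow> {..<Suc (Suc j)}"
        using less_SucI[OF less] by simp
    next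
      fix u v assume uv: "u \<in> U" "v \<in> U" "{u, v} \<in> E"
      with R(3) have "u \<in> R \<or> v \<in> R" unfolding independent_set_def by blast
      thus "(if u \<in> R then c u else Suc j) \<noteq> (if v \<in> R then c v else Suc j)"
        using c(2)[of u v] uv(3) neq[of u] neq[of v] by auto
    qed
  qed
qed

lemma colourable_if_paintable: "paintable G k \<Longrightarrow> colourable G k"
  using colourable_if_correct_wins[of "snd G" "fst G" "\<lambda>_. k - 1" "k - 1"]
  by (auto simp: paintable_def)

text \<open>The assumption makes the \<open>LEAST\<close> in \<open>paintability\<close> an attained
  value.\<close>

lemma chromatic_number_le_paintability:
  "paintable G k \<Longrightarrow> chromatic_number G \<le> paintability G"
  unfolding paintability_def
  by (intro chromatic_number_le colourable_if_paintable) (rule LeastI)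

text \<open>Averaging over the d classes. It serves twice: with exponential weights for the choice
  of Mrs. Correct, and with weight 1 to bound the chromatic number from below.\<close>

lemma heavy_colour_class:
  fixes w :: "'a \<Rightarrow> real"
  assumes "finite S" "colourable (S, E) d"
  obtains I where "I \<subseteq> S" "independent_set E I" "sum w S \<le> real d * sum w I"
proof -
  from assms(2) obtain c where c: "c \<in> S \<rightarrow> {..<d}"
      "\<And>u v. u \<in> S \<Longrightarrow> v \<in> S \<Longrightarrow> {u, v} \<in> E \<Longrightarrow> c u \<noteq> c v"
    by (auto simp: colourable_def)
  have sum_eq: "sum w S = (\<Sum>i<d. sum w {v \<in> S. c v = i})"
    using assms(1) c(1) by (subst sum.group) auto
  show ?thesis
  proof (cases "d = 0")
    case True
    with sum_eq show ?thesis by (intro that[of "{}"]) (auto simp: independent_set_def)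
  next
    case False
    have "\<exists>i<d. sum w S \<le> real d * sum w {v \<in> S. c v = i}"
    proof (rule ccontr)
      assume *: "\<not> ?thesis"
      have "(\<Sum>i<d. real d * sum w {v \<in> S. c v = i}) < (\<Sum>i<d. sum w S)"
        using * False by (intro sum_strict_mono) auto
      hence "real d * sum w S < real d * sum w S"
        using sum_eq by (simp add: sum_distrib_left)
      thus False by simp
    qed
    then obtain i where "sum w S \<le> real d * sum w {v \<in> S. c v = i}" by blast
    thus ?thesis using c(2)
      by (intro that[of "{v \<in> S. c v = i}"]) (fastforce simp: independent_set_def)+
  qed
qed

text \<open>The invariant: \<open>a\<close> rounds with a large presented set have been played, each of which removed
  at least \<open>k\<close> vertices, and \<open>m v\<close> erasers have been used at \<open>v\<close> in rounds with a small set. In the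
  latter rounds the heaviest colour class is kept with respect to the weights
  \<open>(d / (d - 1)) ^ m v\<close>, so that the total weight never increases.\<close>

lemma correct_wins_if_large_small:
  fixes N \<sigma> :: real
  assumes fin: "finite U" and k: "k \<ge> 1" and d: "d \<ge> 2" and N: "N > 0"
    and large: "\<And>S. S \<subseteq> U \<Longrightarrow> \<sigma> \<le> real (card S) \<Longrightarrow> \<exists>I\<subseteq>S. independent_set E I \<and> k \<le> card I"
    and small: "\<And>S. S \<subseteq> U \<Longrightarrow> real (card S) < \<sigma> \<Longrightarrow> colourable (S, E) d"
    and erasers: "\<And>v. v \<in> U \<Longrightarrow> N / real k + real d * ln N \<le> real (r v + a + m v)"
    and removed: "real (a * k + card U) \<le> N"
    and weight: "(\<Sum>v\<in>U. (real d / (real d - 1)) ^ m v) \<le> N"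
  shows "correct_wins E U r"
  using assms
\<comment> \<open>Vertices plus erasers: every presented vertex either leaves or loses an eraser, so
  a nonempty presented set lowers the sum.\<close>
proof (induction "\<Sum>v\<in>U. r v + 1" arbitrary: U r a m rule: less_induct)
  case less
  define \<beta> where "\<beta> = real d / (real d - 1)"
  have \<beta>: "\<beta> > 1" using less.prems(3) by (simp add: \<beta>_def field_simps)
  have ln_\<beta>: "1 / real d \<le> ln \<beta>"
  proof -
    have "ln (1 - 1 / real d) \<le> (1 - 1 / real d) - 1"
      using less.prems(3) by (intro ln_le_minus_one) (simp add: field_simps)
    moreover have "1 - 1 / real d = 1 / \<beta>"
      using less.prems(3) by (simp add: \<beta>_def field_simps)
    ultimately show ?thesis using \<beta> by (simp add: ln_div)
  qed
  \<comment> \<open>No vertex is ever out of erasers. The vertex v itself still counts in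
    \<open>card U\<close>, which makes a < N / k strict, and its weight alone is at most N, which
    with ln \<beta> \<ge> 1 / d gives m v \<le> d * ln N.\<close>
  have r_pos: "0 < r v" if "v \<in> U" for v
  proof -
    have "card U \<ge> 1"
      using that less.prems(1) by (simp add: card_gt_0_iff Suc_le_eq) blast
    hence "real (a * k) < N" using less.prems(8) by simp
    hence 1: "real a < N / real k" using less.prems(2) by (simp add: field_simps)
    have "\<beta> ^ m v \<le> (\<Sum>v\<in>U. \<beta> ^ m v)"
      using that less.prems(1) \<beta> by (intro member_le_sum) auto
    hence "\<beta> ^ m v \<le> N" using less.prems(9) by (simp add: \<beta>_def)
    hence "ln (\<beta> ^ m v) \<le> ln N" using \<beta> by (intro ln_mono) auto
    hence "real (m v) * ln \<beta> \<le> ln N" using \<beta> by (simp add: ln_realpow)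
    moreover have "real (m v) * (1 / real d) \<le> real (m v) * ln \<beta>"
      using ln_\<beta> by (intro mult_left_mono) auto
    ultimately have "real (m v) * (1 / real d) \<le> ln N" by linarith
    hence "real (m v) \<le> real d * ln N"
      using less.prems(3) by (simp add: field_simps)
    with 1 less.prems(7)[OF that] have "real (r v) > 0" by simp
    thus ?thesis by simp
  qed
  show ?case
  proof (rule correct_wins.intros)
    fix S assume S: "S \<subseteq> U" "S \<noteq> {}"
    have finS: "finite S" using S less.prems(1) finite_subset by blast
    \<comment> \<open>The common part of both kinds of rounds: I is kept, and \<open>a'\<close>,
      \<open>m'\<close> are the updated counters.\<close>
    have step: "\<exists>R\<subseteq>S. (\<forall>v\<in>R. 0 < r v) \<and> independent_set E (S - R) \<and>
        correct_wins E (U - (S - R)) (\<lambda>v. if v \<in> R then r v - 1 else r v)"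
      if I: "I \<subseteq> S" "independent_set E I"
        and er: "\<And>v. v \<in> U - I \<Longrightarrow> N / real k + real d * ln N \<le>
                   real ((if v \<in> S - I then r v - 1 else r v) + a' + m' v)"
        and re: "real (a' * k + card (U - I)) \<le> N"
        and we: "(\<Sum>v\<in>U-I. \<beta> ^ m' v) \<le> N" for I a' m'
    proof (intro exI conjI)
      have [simp]: "S - (S - I) = I" using I by blast
      show "S - I \<subseteq> S" by blast
      show "\<forall>v\<in>S-I. 0 < r v" using r_pos S by blast
      show "independent_set E (S - (S - I))" using I by simp
      show "correct_wins E (U - (S - (S - I))) (\<lambda>v. if v \<in> S - I then r v - 1 else r v)"
        unfolding \<open>S - (S - I) = I\<close>
      proof (rule less.hyps[where a = a' and m = m'])
        obtain v where v: "v \<in> S" using S by blast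
        have "(\<Sum>v\<in>U-I. (if v \<in> S - I then r v - 1 else r v) + 1) =
              (\<Sum>v\<in>U. if v \<in> I then 0 else (if v \<in> S - I then r v - 1 else r v) + 1)"
          using less.prems(1) I S by (intro sum.mono_neutral_cong_left) auto
        also have "\<dots> < (\<Sum>v\<in>U. r v + 1)"
          using less.prems(1) v S r_pos[of v]
          by (intro sum_strict_mono_ex1 bexI[of _ v]) auto
        finally show "(\<Sum>v\<in>U-I. (if v \<in> S - I then r v - 1 else r v) + 1) < (\<Sum>v\<in>U. r v + 1)" .
        show "finite (U - I)" using less.prems(1) by simp
        show "(\<Sum>v\<in>U-I. (real d / (real d - 1)) ^ m' v) \<le> N" using we by (simp add: \<beta>_def)
      next
        fix T assume T: "T \<subseteq> U - I" "\<sigma> \<le> real (card T)"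
        thus "\<exists>I\<subseteq>T. independent_set E I \<and> k \<le> card I"
          by (intro less.prems(5)) auto
      next
        fix T assume T: "T \<subseteq> U - I" "real (card T) < \<sigma>"
        thus "colourable (T, E) d"
          by (intro less.prems(6)) auto
      qed (use less.prems(2-4) er re in blast)+
    qed
    show "\<exists>R\<subseteq>S. (\<forall>v\<in>R. 0 < r v) \<and> independent_set E (S - R) \<and>
        correct_wins E (U - (S - R)) (\<lambda>v. if v \<in> R then r v - 1 else r v)"
    proof (cases "\<sigma> \<le> real (card S)")
      case True
      then obtain I where I: "I \<subseteq> S" "independent_set E I" "k \<le> card I"
        using less.prems(5) S by blast
      show ?thesis
      proof (rule step[OF I(1,2), of "Suc a" m])
        fix v assume "v \<in> U - I"
        thus "N / real k + real d * ln N \<le>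
                real ((if v \<in> S - I then r v - 1 else r v) + Suc a + m v)"
          using less.prems(7)[of v] r_pos[of v] by (auto simp: of_nat_diff)
      next
        have "card (U - I) = card U - card I" "card I \<le> card U"
          using I S less.prems(1) finS
          by (auto intro!: card_Diff_subset card_mono intro: finite_subset)
        hence "Suc a * k + card (U - I) \<le> a * k + card U" using I(3) by simp
        thus "real (Suc a * k + card (U - I)) \<le> N"
          using less.prems(8) of_nat_mono[of "Suc a * k + card (U - I)" _, where 'a = real]
          by (meson order_trans)
      next
        have "(\<Sum>v\<in>U-I. \<beta> ^ m v) \<le> (\<Sum>v\<in>U. \<beta> ^ m v)"
          using less.prems(1) \<beta> by (intro sum_mono2) auto
        thus "(\<Sum>v\<in>U-I. \<beta> ^ m v) \<le> N" using less.prems(9) by (simp add: \<beta>_def)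
      qed
    next
      case False
      hence "colourable (S, E) d" using less.prems(6) S by auto
      then obtain I where I: "I \<subseteq> S" "independent_set E I"
          "(\<Sum>v\<in>S. \<beta> ^ m v) \<le> real d * (\<Sum>v\<in>I. \<beta> ^ m v)"
        using heavy_colour_class[OF finS, of E d "\<lambda>v. \<beta> ^ m v"] by blast
      define m' where "m' = (\<lambda>v. if v \<in> S - I then Suc (m v) else m v)"
      show ?thesis
      proof (rule step[OF I(1,2), of a m'])
        fix v assume "v \<in> U - I"
        thus "N / real k + real d * ln N \<le>
                real ((if v \<in> S - I then r v - 1 else r v) + a + m' v)"
          using less.prems(7)[of v] r_pos[of v] by (auto simp: of_nat_diff m'_def)
      next
        have "card (U - I) \<le> card U" using less.prems(1) by (intro card_mono) auto
        thus "real (a * k + card (U - I)) \<le> N"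
          using less.prems(8) by linarith
      next
        let ?W = "\<lambda>A. \<Sum>v\<in>A. \<beta> ^ m v"
        have finI: "finite I" using I(1) finS finite_subset by blast
        have U: "U - I = (U - S) \<union> (S - I)" using I S by blast
        have "(\<Sum>v\<in>U-I. \<beta> ^ m' v) = (\<Sum>v\<in>U-S. \<beta> ^ m' v) + (\<Sum>v\<in>S-I. \<beta> ^ m' v)"
          unfolding U using less.prems(1) finS by (intro sum.union_disjoint) auto
        also have "(\<Sum>v\<in>U-S. \<beta> ^ m' v) = ?W (U - S)"
          by (intro sum.cong) (auto simp: m'_def)
        also have "(\<Sum>v\<in>S-I. \<beta> ^ m' v) = \<beta> * ?W (S - I)"
          unfolding sum_distrib_left by (intro sum.cong) (auto simp: m'_def)
        \<comment> \<open>I carries at least a 1 / d share of the weight of S, so S - I has at most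
          the share 1 - 1 / d = 1 / \<beta>, which offsets the growth by \<beta>.\<close>
        also have "\<beta> * ?W (S - I) \<le> ?W S"
        proof -
          have "?W (S - I) = ?W S - ?W I"
            using I finS by (intro sum_diff) auto
          hence "real d * ?W (S - I) \<le> (real d - 1) * ?W S"
            using I(3) by (simp only: left_diff_distrib right_diff_distrib)
          thus ?thesis using less.prems(3) by (simp add: \<beta>_def field_simps)
        qed
        also have "?W (U - S) + ?W S = ?W U"
          using S less.prems(1) by (metis sum.subset_diff)
        finally show "(\<Sum>v\<in>U-I. \<beta> ^ m' v) \<le> N" using less.prems(9) by (simp add: \<beta>_def)
      qed
    qed
  qed
qed

lemma paintable_if_large_small:
  fixes V :: "'a set" and \<sigma> :: real
  assumes fin: "finite V" "V \<noteq> {}" and k: "k \<ge> 1" and d: "d \<ge> 2"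
    and large: "\<And>S. S \<subseteq> V \<Longrightarrow> \<sigma> \<le> real (card S) \<Longrightarrow> \<exists>I\<subseteq>S. independent_set E I \<and> k \<le> card I"
    and small: "\<And>S. S \<subseteq> V \<Longrightarrow> real (card S) < \<sigma> \<Longrightarrow> colourable (S, E) d"
    and K: "real (card V) / real k + real d * ln (real (card V)) \<le> real K"
  shows "paintable (V, E) (Suc K)"
proof -
  \<comment> \<open>With a = 0 and all weights 1, both budgets start exactly at N =
    \<open>card V\<close>.\<close>
  have "correct_wins E V (\<lambda>_. K)"
    by (rule correct_wins_if_large_small[where N = "real (card V)" and a = 0 and m = "\<lambda>_. 0" and k = k and d = d and \<sigma> = \<sigma>])
      (use assms in \<open>auto simp: card_gt_0_iff\<close>)
  thus ?thesis by (simp add: paintable_def)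
qed

section \<open>Greedy independent sets\<close>

definition pairs_of :: "'a set \<Rightarrow> 'a set set" where
  "pairs_of A = {e. e \<subseteq> A \<and> card e = 2}"

definition independent_in :: "('a set \<Rightarrow> bool) \<Rightarrow> 'a set \<Rightarrow> bool" where
  "independent_in X I \<longleftrightarrow> (\<forall>e\<in>pairs_of I. \<not> X e)"

definition has_independent :: "('a set \<Rightarrow> bool) \<Rightarrow> 'a set \<Rightarrow> nat \<Rightarrow> bool" where
  "has_independent X A j \<longleftrightarrow> (\<exists>I\<subseteq>A. card I = j \<and> finite I \<and> independent_in X I)"

abbreviation edge_pmf :: "'a set set \<Rightarrow> real \<Rightarrow> ('a set \<Rightarrow> bool) pmf" where
  "edge_pmf D p \<equiv> Pi_pmf D False (\<lambda>_. bernoulli_pmf p)"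

lemma finite_pairs_of: "finite A \<Longrightarrow> finite (pairs_of A)"
  unfolding pairs_of_def by (rule finite_subset[of _ "Pow A"]) auto

lemma pairs_of_mono: "A \<subseteq> B \<Longrightarrow> pairs_of A \<subseteq> pairs_of B"
  by (auto simp: pairs_of_def)

lemma card_pairs_of: "finite A \<Longrightarrow> card (pairs_of A) = card A choose 2"
  unfolding pairs_of_def by (rule n_subsets)

lemma pair_in_pairs_of: "u \<in> A \<Longrightarrow> v \<in> A \<Longrightarrow> u \<noteq> v \<Longrightarrow> {u, v} \<in> pairs_of A"
  by (auto simp: pairs_of_def)

lemma has_independent_cong:
  "(\<And>e. e \<in> pairs_of A \<Longrightarrow> X e = Y e) \<Longrightarrow> has_independent X A j = has_independent Y A j"
  using pairs_of_mono unfolding has_independent_def independent_in_def by (metis subsetD)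

lemma has_independent_zero [simp]: "has_independent X A 0"
  unfolding has_independent_def independent_in_def pairs_of_def
  by (intro exI[of _ "{}"]) auto

lemma has_independent_mono: "has_independent X A j \<Longrightarrow> A \<subseteq> B \<Longrightarrow> has_independent X B j"
  unfolding has_independent_def by blast

lemma has_independent_Suc:
  assumes "has_independent X {u \<in> A - {v}. \<not> X {v, u}} j" "v \<in> A"
  shows "has_independent X A (Suc j)"
proof -
  obtain I where I: "I \<subseteq> {u \<in> A - {v}. \<not> X {v, u}}" "card I = j" "finite I" "independent_in X I"
    using assms unfolding has_independent_def by blast
  have "independent_in X (insert v I)"
    unfolding independent_in_def
  proof
    fix e assume "e \<in> pairs_of (insert v I)"
    then obtain a b where e: "e = {a, b}" "a \<noteq> b" "a \<in> insert v I" "b \<in> insert v I"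
      by (auto simp: pairs_of_def card_2_iff)
    thus "\<not> X e"
      using I by (cases "a = v"; cases "b = v")
        (auto simp: insert_commute independent_in_def dest: pair_in_pairs_of)
  qed
  moreover have "v \<notin> I" using I by blast
  ultimately show ?thesis
    unfolding has_independent_def using I assms(2)
    by (intro exI[of _ "insert v I"]) auto
qed

text \<open>The product measure over \<open>D\<close> is the product of those over \<open>D1\<close>
  and \<open>D - D1\<close>, so the edges in \<open>D1\<close> may be exposed first while the others
  stay independent of the outcome f.\<close>

lemma prob_edge_pmf_split:
  assumes "finite D" "D1 \<subseteq> D"
  shows "measure_pmf.prob (edge_pmf D p) {X. P X} =
    measure_pmf.expectation (edge_pmf D1 p)
      (\<lambda>f. measure_pmf.prob (edge_pmf (D - D1) p) {g. P (\<lambda>e. if e \<in> D1 then f e else g e)})"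
proof -
  let ?F = "\<lambda>f. measure_pmf.prob (edge_pmf (D - D1) p) {g. P (\<lambda>e. if e \<in> D1 then f e else g e)}"
  let ?M = "\<lambda>f. map_pmf (\<lambda>g e. if e \<in> D1 then f e else g e) (edge_pmf (D - D1) p)"
  have "finite D1" using assms finite_subset by blast
  hence "edge_pmf (D1 \<union> (D - D1)) p = map_pmf (\<lambda>(f, g) e. if e \<in> D1 then f e else g e)
      (pair_pmf (edge_pmf D1 p) (edge_pmf (D - D1) p))"
    using assms by (intro Pi_pmf_union) auto
  also have "\<dots> = bind_pmf (edge_pmf D1 p) ?M"
    by (simp add: pair_pmf_def map_bind_pmf map_pmf_def bind_assoc_pmf bind_return_pmf)
  also have "D1 \<union> (D - D1) = D" using assms by blast
  finally have "measure_pmf.prob (edge_pmf D p) {X. P X} =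
      measure_pmf.prob (bind_pmf (edge_pmf D1 p) ?M) {X. P X}" by simp
  also have "\<dots> = measure_pmf.expectation (edge_pmf D1 p) (\<lambda>f. measure_pmf.prob (?M f) {X. P X})"
  proof -
    have "ennreal (measure_pmf.prob (bind_pmf (edge_pmf D1 p) ?M) {X. P X}) =
        (\<integral>\<^sup>+ f. ennreal (measure_pmf.prob (?M f) {X. P X}) \<partial>edge_pmf D1 p)"
      by (simp only: measure_pmf.emeasure_eq_measure[symmetric] emeasure_bind_pmf)
    also have "\<dots> = ennreal (measure_pmf.expectation (edge_pmf D1 p) (\<lambda>f. measure_pmf.prob (?M f) {X. P X}))"
      by (intro nn_integral_eq_integral measure_pmf.integrable_const_bound[where B = 1]) auto
    finally show ?thesis by (subst (asm) ennreal_inj) auto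
  qed
  finally show ?thesis by (simp add: vimage_def)
qed

lemma prob_edges_present:
  assumes "finite D" "F \<subseteq> D" "0 \<le> p" "p \<le> 1"
  shows "measure_pmf.prob (edge_pmf D p) {X. \<forall>e\<in>F. X e} = p ^ card F"
proof -
  have "{X. \<forall>e\<in>F. X e} = Pi D (\<lambda>e. if e \<in> F then {True} else UNIV)"
    using assms(2) by (auto simp: Pi_def split: if_splits)
  hence "measure_pmf.prob (edge_pmf D p) {X. \<forall>e\<in>F. X e} =
      (\<Prod>e\<in>D. measure_pmf.prob (bernoulli_pmf p) (if e \<in> F then {True} else UNIV))"
    using assms(1) by (simp add: measure_Pi_pmf_Pi)
  also have "\<dots> = (\<Prod>e\<in>D. if e \<in> F then p else 1)"
    using assms by (intro prod.cong) (auto simp: measure_pmf_single)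
  also have "\<dots> = p ^ card F"
    using assms by (simp add: prod.If_cases Int_absorb1)
  finally show ?thesis .
qed

lemma prob_edges_absent:
  assumes "finite D" "F \<subseteq> D" "0 \<le> p" "p \<le> 1"
  shows "measure_pmf.prob (edge_pmf D p) {X. \<forall>e\<in>F. \<not> X e} = (1 - p) ^ card F"
proof -
  have "{X. \<forall>e\<in>F. \<not> X e} = Pi D (\<lambda>e. if e \<in> F then {False} else UNIV)"
    using assms(2) by (auto simp: Pi_def split: if_splits)
  hence "measure_pmf.prob (edge_pmf D p) {X. \<forall>e\<in>F. \<not> X e} =
      (\<Prod>e\<in>D. measure_pmf.prob (bernoulli_pmf p) (if e \<in> F then {False} else UNIV))"
    using assms(1) by (simp add: measure_Pi_pmf_Pi)
  also have "\<dots> = (\<Prod>e\<in>D. if e \<in> F then 1 - p else 1)"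
    using assms by (intro prod.cong) (auto simp: measure_pmf_single)
  also have "\<dots> = (1 - p) ^ card F"
    using assms by (simp add: prod.If_cases Int_absorb1)
  finally show ?thesis .
qed

section \<open>Failure probability of repeated greedy runs\<close>

lemma exp_minus_double_le:
  fixes q :: real
  assumes "0 \<le> q" "q \<le> 1/2"
  shows "exp (- 2 * q) \<le> 1 - q"
proof -
  have "1 \<le> (1 - q) * (1 + 2 * q)"
  proof -
    have "0 \<le> q * (1 - 2 * q)" using assms by (intro mult_nonneg_nonneg) auto
    thus ?thesis by (simp add: algebra_simps)
  qed
  also have "\<dots> \<le> (1 - q) * exp (2 * q)"
    using assms by (intro mult_left_mono) auto
  finally show ?thesis by (simp add: exp_minus field_simps)
qed

text \<open>A holds the candidates of the current run, not adjacent to any vertex chosen in it; B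
  holds the vertices discarded during the run; j more vertices are to be chosen. The second conjunct
  carries the overall goal along, so that it is still available at a restart.\<close>

definition greedy_fails :: "nat \<Rightarrow> 'a set \<Rightarrow> 'a set \<Rightarrow> nat \<Rightarrow> ('a set \<Rightarrow> bool) \<Rightarrow> bool" where
  "greedy_fails k A B j X \<longleftrightarrow> \<not> has_independent X A j \<and> \<not> has_independent X (A \<union> B) k"

text \<open>Up to the factor with \<open>\<theta>\<close>, the bound is for the probability that \<open>a\<close> candidates run out before \<open>j\<close>
  more vertices are chosen. The rates satisfy \<open>p + (1 - p) * (1 - greedy_rate p j) = 1 - greedy_rate p (Suc j)\<close>,
  where the left-hand side is the mean effect of one candidate surviving the next choice or not. Starting
  them at \<open>1 / 2\<close> rather than \<open>1\<close> limits the loss from removing the chosen vertices themselves to \<open>exp (1 / p)\<close>.\<close>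

definition greedy_rate :: "real \<Rightarrow> nat \<Rightarrow> real" where
  "greedy_rate p j = (1 - p) ^ j / 2"

text \<open>m counts the vertices that are left. Each choice lowers m and j by one, so m - j is
  constant during a run and the \<theta>-factor changes only at a restart, when j goes back to
  k.\<close>

definition greedy_bound :: "real \<Rightarrow> real \<Rightarrow> real \<Rightarrow> nat \<Rightarrow> nat \<Rightarrow> nat \<Rightarrow> real" where
  "greedy_bound p \<theta> M j a m = exp (2 * (\<Sum>i=1..j. greedy_rate p i)) * (1 - greedy_rate p j) ^ a *
     exp (- \<theta> * (real m - real j - M))"

lemma greedy_rate_bounds:
  assumes "0 < p" "p < 1"
  shows "0 \<le> greedy_rate p i" "greedy_rate p i \<le> 1/2"
  using assms by (auto simp: greedy_rate_def power_le_one)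

text \<open>A new run raises the \<theta>-factor by exp (\<theta> * k), for the vertices it may use
  up. The remaining factors are at most exp (1 / p - q * M) with q = \<open>greedy_rate p k\<close>,
  and \<open>cond\<close> says that this pays for it.\<close>

lemma greedy_bound_restart:
  assumes p: "0 < p" "p < 1" and cond: "1 / p - (1 - p) ^ k * M / 2 \<le> - \<theta> * real k"
    and m: "M \<le> real m"
  shows "greedy_bound p \<theta> M k m m \<le> exp (- \<theta> * (real m - M))"
proof -
  note q = greedy_rate_bounds[OF p]
  have "greedy_bound p \<theta> M k m m \<le>
      exp (1 / p) * exp (- greedy_rate p k * M) * exp (- \<theta> * (real m - real k - M))"
    unfolding greedy_bound_def
  proof (intro mult_mono order.refl)
    have "(\<Sum>i=1..k. (1 - p) ^ i) \<le> 1 / p"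
    proof -
      have "(\<Sum>i=1..k. (1 - p) ^ i) \<le> (\<Sum>i<Suc k. (1 - p) ^ i)"
        using p by (intro sum_mono2) auto
      also have "\<dots> = (1 - (1 - p) ^ Suc k) / p"
        using p by (subst sum_gp_strict) auto
      also have "\<dots> \<le> 1 / p" using p by (intro divide_right_mono) auto
      finally show ?thesis .
    qed
    thus "exp (2 * (\<Sum>i=1..k. greedy_rate p i)) \<le> exp (1 / p)"
      by (simp add: greedy_rate_def sum_divide_distrib[symmetric])
    have "(1 - greedy_rate p k) ^ m \<le> exp (- greedy_rate p k) ^ m"
      using q[of k] exp_ge_add_one_self[of "- greedy_rate p k"] by (intro power_mono) auto
    also have "\<dots> = exp (- greedy_rate p k * real m)" by (simp add: exp_of_nat_mult[symmetric] mult_ac)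
    also have "\<dots> \<le> exp (- greedy_rate p k * M)"
      using m q[of k] by (simp add: mult_left_mono)
    finally show "(1 - greedy_rate p k) ^ m \<le> exp (- greedy_rate p k * M)" .
    show "0 \<le> (1 - greedy_rate p k) ^ m" using q[of k] by (intro zero_le_power) linarith
  qed auto
  also have "\<dots> = exp (1 / p - greedy_rate p k * M + \<theta> * real k - \<theta> * (real m - M))"
    by (simp add: exp_add[symmetric] algebra_simps)
  also have "\<dots> \<le> exp (- \<theta> * (real m - M))"
    using cond by (simp add: greedy_rate_def)
  finally show ?thesis .
qed

text \<open>Exposing the edges from a vertex \<open>v\<close> of \<open>A\<close> to the rest of \<open>A\<close> moves the neighbours of \<open>v\<close> from
  \<open>A\<close> to \<open>B\<close> and leaves the edges inside the remaining \<open>A \<union> B - {v}\<close> untouched; this is one step of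
  the greedy construction of an independent set in \<open>A\<close>. When \<open>A\<close> runs empty, the construction is
  restarted on \<open>B\<close>. The factor with \<open>\<theta>\<close> counts the failed attempts.\<close>

lemma prob_no_independent_step:
  fixes A B :: "'a set" and p \<theta> M :: real
  assumes p: "0 < p" "p < 1"
    and IH: "\<And>D (A' :: 'a set) B'. finite D \<Longrightarrow> finite A' \<Longrightarrow> finite B' \<Longrightarrow> A' \<inter> B' = {} \<Longrightarrow>
      pairs_of (A' \<union> B') \<subseteq> D \<Longrightarrow> Suc (card (A' \<union> B')) = card (A \<union> B) \<Longrightarrow>
      measure_pmf.prob (edge_pmf D p) {X. greedy_fails k A' B' j X} \<le> greedy_bound p \<theta> M j (card A') (card (A' \<union> B'))"
    and A: "finite A" "finite B" "A \<inter> B = {}" "v \<in> A" "pairs_of (A \<union> B) \<subseteq> D" "finite D"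
  shows "measure_pmf.prob (edge_pmf D p) {X. greedy_fails k A B (Suc j) X} \<le> greedy_bound p \<theta> M (Suc j) (card A) (card (A \<union> B))"
proof -
  define D1 where "D1 = (\<lambda>u. {v, u}) ` (A - {v})"
  define N where "N = (\<lambda>f. {u \<in> A - {v}. \<not> f {v, u}})"
  define N' where "N' = (\<lambda>f. B \<union> {u \<in> A - {v}. f {v, u}})"
  have NN: "N f \<union> N' f = A \<union> B - {v}" "N f \<inter> N' f = {}" "finite (N f)" "finite (N' f)" for f
    using A by (auto simp: N_def N'_def)
  have D1: "D1 \<subseteq> D" using A(4,5) pair_in_pairs_of[of v "A \<union> B"] by (auto simp: D1_def)
  have inj: "inj_on (\<lambda>u. {v, u}) (A - {v})" by (auto simp: inj_on_def doubleton_eq_iff)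
  have finD1: "finite D1" using A by (simp add: D1_def)
  have disj: "pairs_of (A \<union> B - {v}) \<inter> D1 = {}" by (auto simp: D1_def pairs_of_def)
  note q = greedy_rate_bounds[OF p]
  have card: "Suc (card (A \<union> B - {v})) = card (A \<union> B)"
    using A by (metis UnI1 card_Suc_Diff1 finite_UnI)
  define c where "c = exp (2 * (\<Sum>i=1..j. greedy_rate p i)) * exp (- \<theta> * (real (card (A \<union> B - {v})) - real j - M))"
  have "measure_pmf.prob (edge_pmf D p) {X. greedy_fails k A B (Suc j) X} =
    measure_pmf.expectation (edge_pmf D1 p)
      (\<lambda>f. measure_pmf.prob (edge_pmf (D - D1) p) {g. greedy_fails k A B (Suc j) (\<lambda>e. if e \<in> D1 then f e else g e)})"
    by (rule prob_edge_pmf_split[OF A(6) D1])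
  \<comment> \<open>Given f, the bound from \<open>IH\<close> depends only on the number of
    candidates not adjacent to v, so it is a product over \<open>D1\<close> and its mean
    factorises.\<close>
  also have "\<dots> \<le> measure_pmf.expectation (edge_pmf D1 p) (\<lambda>f. c * (\<Prod>e\<in>D1. if f e then 1 else 1 - greedy_rate p j))"
  proof (intro integral_mono)
    fix f :: "'a set \<Rightarrow> bool"
    have "measure_pmf.prob (edge_pmf (D - D1) p) {g. greedy_fails k A B (Suc j) (\<lambda>e. if e \<in> D1 then f e else g e)}
        \<le> measure_pmf.prob (edge_pmf (D - D1) p) {g. greedy_fails k (N f) (N' f) j g}"
    proof (intro measure_pmf.finite_measure_mono subsetI)
      fix g assume g: "g \<in> {g. greedy_fails k A B (Suc j) (\<lambda>e. if e \<in> D1 then f e else g e)}"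
      define h where "h = (\<lambda>e. if e \<in> D1 then f e else g e)"
      have h: "\<not> has_independent h A (Suc j)" "\<not> has_independent h (A \<union> B) k"
        using g by (auto simp: greedy_fails_def h_def)
      have eq: "has_independent h A' i = has_independent g A' i" if "A' \<subseteq> A \<union> B - {v}" for A' i
        using disj pairs_of_mono[OF that] by (intro has_independent_cong) (auto simp: h_def)
      have sub: "N f \<subseteq> A \<union> B - {v}" using NN(1)[of f] by blast
      have "{u \<in> A - {v}. \<not> h {v, u}} = N f" by (auto simp: N_def D1_def h_def)
      hence "\<not> has_independent h (N f) j"
        using h(1) has_independent_Suc[of h A v j] A(4) by metis
      hence 1: "\<not> has_independent g (N f) j" using eq[OF sub] by simp
      have "\<not> has_independent h (A \<union> B - {v}) k"
        using h(2) has_independent_mono[of h "A \<union> B - {v}" k "A \<union> B"] by blast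
      hence "\<not> has_independent g (A \<union> B - {v}) k" using eq[OF order.refl] by simp
      with 1 show "g \<in> {g. greedy_fails k (N f) (N' f) j g}"
        by (simp add: greedy_fails_def NN(1))
    qed auto
    also have "\<dots> \<le> greedy_bound p \<theta> M j (card (N f)) (card (N f \<union> N' f))"
    proof (rule IH)
      show "pairs_of (N f \<union> N' f) \<subseteq> D - D1"
        using disj A(5) pairs_of_mono[of "A \<union> B - {v}" "A \<union> B"] NN(1)[of f] by auto
    qed (use A NN card in auto)
    also have "\<dots> = c * (1 - greedy_rate p j) ^ card (N f)"
      by (simp add: greedy_bound_def c_def NN(1))
    also have "(1 - greedy_rate p j) ^ card (N f) = (\<Prod>u\<in>A-{v}. if f {v, u} then 1 else 1 - greedy_rate p j)"
      using A(1) by (subst prod.If_cases) (auto simp: N_def intro!: arg_cong[of _ _ card] arg_cong[of _ _ "\<lambda>i. _ ^ i"])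
    also have "\<dots> = (\<Prod>e\<in>D1. if f e then 1 else 1 - greedy_rate p j)"
      unfolding D1_def by (subst prod.reindex[OF inj]) (simp add: o_def)
    finally show "measure_pmf.prob (edge_pmf (D - D1) p) {g. greedy_fails k A B (Suc j) (\<lambda>e. if e \<in> D1 then f e else g e)}
        \<le> c * (\<Prod>e\<in>D1. if f e then 1 else 1 - greedy_rate p j)" .
  next
    show "integrable (edge_pmf D1 p) (\<lambda>f. c * (\<Prod>e\<in>D1. if f e then 1 else 1 - greedy_rate p j))"
      using finD1 q by (intro integrable_mult_right integrable_prod_Pi_pmf[where f = "\<lambda>_ y. if y then 1 else 1 - greedy_rate p j"])
        (auto intro: integrable_measure_pmf_finite)
  qed (auto intro!: measure_pmf.integrable_const_bound[where B = 1])
  also have "\<dots> = c * (\<Prod>e\<in>D1. measure_pmf.expectation (bernoulli_pmf p) (\<lambda>y. if y then 1 else 1 - greedy_rate p j))"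
  proof -
    have "1 - greedy_rate p j \<ge> 0" using q(2)[of j] by linarith
    thus ?thesis using finD1
      by (subst integral_mult_right_zero, subst expectation_prod_Pi_pmf)
        (auto intro: integrable_measure_pmf_finite)
  qed
  also have "measure_pmf.expectation (bernoulli_pmf p) (\<lambda>y. if y then 1 else 1 - greedy_rate p j) = 1 - greedy_rate p (Suc j)"
    using p by (simp add: greedy_rate_def field_simps)
  also have "(\<Prod>e\<in>D1. 1 - greedy_rate p (Suc j)) = (1 - greedy_rate p (Suc j)) ^ (card A - 1)"
    using A card_image[OF inj] by (simp add: D1_def)
  \<comment> \<open>The chosen vertex v leaves A, so one factor 1 - q is missing. It is at least exp
    (- 2 * q) because q \<le> 1 / 2, and the loss is collected in the sum in the exponent of
    \<open>greedy_bound\<close>.\<close>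
  also have "c * (1 - greedy_rate p (Suc j)) ^ (card A - 1) \<le>
      c * (exp (2 * greedy_rate p (Suc j)) * (1 - greedy_rate p (Suc j)) * (1 - greedy_rate p (Suc j)) ^ (card A - 1))"
  proof -
    have "exp (- 2 * greedy_rate p (Suc j)) \<le> 1 - greedy_rate p (Suc j)" by (rule exp_minus_double_le[OF q])
    hence "1 \<le> exp (2 * greedy_rate p (Suc j)) * (1 - greedy_rate p (Suc j))"
      by (simp add: exp_minus field_simps)
    moreover have "1 - greedy_rate p (Suc j) \<ge> 0" using q(2)[of "Suc j"] by linarith
    ultimately have "1 * (1 - greedy_rate p (Suc j)) ^ (card A - 1) \<le> 
      exp (2 * greedy_rate p (Suc j)) * (1 - greedy_rate p (Suc j)) * (1 - greedy_rate p (Suc j)) ^ (card A - 1)"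
      by (intro mult_right_mono) auto
    thus ?thesis by (intro mult_left_mono) (auto simp: c_def)
  qed
  also have "\<dots> = greedy_bound p \<theta> M (Suc j) (card A) (card (A \<union> B))"
  proof -
    have "(1 - greedy_rate p (Suc j)) * (1 - greedy_rate p (Suc j)) ^ (card A - 1) = (1 - greedy_rate p (Suc j)) ^ card A"
      using A by (metis card_Suc_Diff1 card_Diff_singleton power_Suc)
    moreover have "real (card (A \<union> B)) - real (Suc j) = real (card (A \<union> B - {v})) - real j"
      using card by linarith
    ultimately show ?thesis
      by (simp add: greedy_bound_def c_def exp_add distrib_left mult_ac del: of_nat_Suc)
  qed
  finally show ?thesis .
qed

text \<open>Induction on the number of remaining vertices, for all j at once because a restart puts
  j back to k.\<close>

lemma prob_no_independent_aux:
  fixes A B :: "'a set" and p \<theta> M :: real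
  assumes p: "0 < p" "p < 1" and \<theta>: "\<theta> \<ge> 0" and M: "M > 0" and k: "k \<ge> 1"
    and cond: "1 / p - (1 - p) ^ k * M / 2 \<le> - \<theta> * real k"
    and A: "finite A" "finite B" "A \<inter> B = {}" "pairs_of (A \<union> B) \<subseteq> D" "finite D"
  shows "measure_pmf.prob (edge_pmf D p) {X. greedy_fails k A B j X} \<le> greedy_bound p \<theta> M j (card A) (card (A \<union> B))"
  using A
proof (induction "card (A \<union> B)" arbitrary: A B D j rule: less_induct)
  case less
  note A = less.prems
  note q = greedy_rate_bounds[OF p]
  \<comment> \<open>Stated for every split of the same vertex set: a restart alone does not lower
    the number of vertices, so it is joined with a greedy step on B.\<close>
  have step: "measure_pmf.prob (edge_pmf D p) {X. greedy_fails k A' B' (Suc i) X} \<le> greedy_bound p \<theta> M (Suc i) (card A') (card (A' \<union> B'))"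
    if "A' \<union> B' = A \<union> B" "A' \<inter> B' = {}" "A' \<noteq> {}" for A' B' i
  proof -
    obtain v where "v \<in> A'" using \<open>A' \<noteq> {}\<close> by blast
    moreover have "finite A'" "finite B'" using A(1,2) that(1) by (metis finite_Un)+
    moreover have "measure_pmf.prob (edge_pmf D'' p) {X. greedy_fails k A'' B'' i X} \<le>
        greedy_bound p \<theta> M i (card A'') (card (A'' \<union> B''))"
      if "finite D''" "finite A''" "finite B''" "A'' \<inter> B'' = {}" "pairs_of (A'' \<union> B'') \<subseteq> D''"
        "Suc (card (A'' \<union> B'')) = card (A' \<union> B')" for A'' B'' :: "'a set" and D''
      using that \<open>A' \<union> B' = A \<union> B\<close> by (intro less.hyps) auto
    ultimately show ?thesis
      using that A by (intro prob_no_independent_step[OF p]) auto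
  qed
  show ?case
  proof (cases j)
    case 0
    have "1 - greedy_rate p 0 \<ge> 0" using q(2)[of 0] by linarith
    moreover have "{X. greedy_fails k A B j X} = {}" using 0 by (simp add: greedy_fails_def)
    ultimately show ?thesis using 0 by (simp only: measure_empty) (simp add: greedy_bound_def)
  next
    case (Suc i)
    show ?thesis
    proof (cases "A = {}")
      case False
      thus ?thesis using step[of A B i] A Suc by simp
    next
      case True
      let ?m = "card (A \<union> B)"
      \<comment> \<open>What the bound leaves when A has run empty. It is trivial below M vertices,
        and otherwise a fresh run on B attains it.\<close>
      have le: "exp (- \<theta> * (real ?m - M)) \<le> greedy_bound p \<theta> M j (card A) ?m"
      proof -
        have "exp (- \<theta> * (real ?m - M)) \<le> exp (- \<theta> * (real ?m - real j - M))"
          using \<theta> by (simp add: algebra_simps)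
        also have "\<dots> \<le> exp (2 * (\<Sum>i=1..j. greedy_rate p i)) * exp (- \<theta> * (real ?m - real j - M))"
          using q by (simp add: sum_nonneg)
        finally show ?thesis using True by (simp add: greedy_bound_def)
      qed
      show ?thesis
      proof (cases "real ?m < M")
        case True
        hence "1 \<le> exp (- \<theta> * (real ?m - M))"
          using \<theta> by (simp add: mult_nonneg_nonpos)
        hence "1 \<le> greedy_bound p \<theta> M j (card A) ?m" using le by linarith
        thus ?thesis by (meson measure_pmf.prob_le_1 order_trans)
      next
        case False
        hence "B \<noteq> {}" using M True by auto
        obtain k' where k': "k = Suc k'" using k by (cases k) auto
        have "measure_pmf.prob (edge_pmf D p) {X. greedy_fails k A B j X} \<le> measure_pmf.prob (edge_pmf D p) {X. greedy_fails k B {} k X}"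
          using True by (intro measure_pmf.finite_measure_mono) (auto simp: greedy_fails_def)
        also have "\<dots> \<le> greedy_bound p \<theta> M k (card B) (card (B \<union> {}))"
          using step[of B "{}" k'] True \<open>B \<noteq> {}\<close> k' by simp
        also have "\<dots> \<le> exp (- \<theta> * (real ?m - M))"
          using greedy_bound_restart[OF p cond] True False by simp
        also note le
        finally show ?thesis .
      qed
    qed
  qed
qed

lemma prob_no_independent:
  fixes p \<theta> M :: real
  assumes p: "0 < p" "p < 1" and \<theta>: "\<theta> \<ge> 0" and M: "M > 0" and k: "k \<ge> 1"
    and cond: "1 / p - (1 - p) ^ k * M / 2 \<le> - \<theta> * real k"
    and A: "finite A" "pairs_of A \<subseteq> D" "finite D"
  shows "measure_pmf.prob (edge_pmf D p) {X. \<not> has_independent X A k} \<le> exp (- \<theta> * (real (card A) - M))"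
proof (cases "real (card A) < M")
  case True
  hence "1 \<le> exp (- \<theta> * (real (card A) - M))"
    using \<theta> by (simp add: mult_nonneg_nonpos)
  thus ?thesis by (meson measure_pmf.prob_le_1 order_trans)
next
  case False
  have "measure_pmf.prob (edge_pmf D p) {X. \<not> has_independent X A k} =
      measure_pmf.prob (edge_pmf D p) {X. greedy_fails k A {} k X}"
    by (simp add: greedy_fails_def)
  also have "\<dots> \<le> greedy_bound p \<theta> M k (card A) (card A)"
    using prob_no_independent_aux[OF p \<theta> M k cond, of A "{}" D k] A by simp
  also have "\<dots> \<le> exp (- \<theta> * (real (card A) - M))"
    using False by (intro greedy_bound_restart p cond) auto
  finally show ?thesis .
qed

section \<open>First moment bounds\<close>

text \<open>A vertex of low degree is coloured last. Loops are excluded since {v, v} is {v}, which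
  no colouring could respect.\<close>

lemma colourable_if_degenerate:
  assumes "finite S" "\<And>v. v \<in> S \<Longrightarrow> {v} \<notin> E"
    and "\<And>T. T \<subseteq> S \<Longrightarrow> T \<noteq> {} \<Longrightarrow> \<exists>v\<in>T. card {u \<in> T. {v, u} \<in> E} < d"
  shows "colourable (S, E) d"
  using assms
proof (induction "card S" arbitrary: S rule: less_induct)
  case less
  show ?case
  proof (cases "S = {}")
    case True
    thus ?thesis by (auto simp: colourable_def)
  next
    case False
    then obtain v where v: "v \<in> S" "card {u \<in> S. {v, u} \<in> E} < d"
      using less.prems(3)[of S] by auto
    have "colourable (S - {v}, E) d"
    proof (rule less.hyps)
      show "card (S - {v}) < card S"
        using v(1) less.prems(1) by (meson card_Diff1_less)
      fix T assume "T \<subseteq> S - {v}" "T \<noteq> {}"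
      thus "\<exists>v\<in>T. card {u \<in> T. {v, u} \<in> E} < d"
        by (intro less.prems(3)) auto
    qed (use less.prems in auto)
    then obtain c where c: "c \<in> (S - {v}) \<rightarrow> {..<d}"
        "\<And>x y. x \<in> S - {v} \<Longrightarrow> y \<in> S - {v} \<Longrightarrow> {x, y} \<in> E \<Longrightarrow> c x \<noteq> c y"
      by (auto simp: colourable_def)
    have "card (c ` {u \<in> S. {v, u} \<in> E}) < card {..<d}"
      using v(2) card_image_le[of "{u \<in> S. {v, u} \<in> E}" c] less.prems(1) by simp
    moreover have "finite (c ` {u \<in> S. {v, u} \<in> E})" using less.prems(1) by simp
    ultimately have "\<not> {..<d} \<subseteq> c ` {u \<in> S. {v, u} \<in> E}"
      using card_mono[of "c ` {u \<in> S. {v, u} \<in> E}" "{..<d}"] by linarith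
    then obtain i where i: "i < d" "\<And>u. u \<in> S \<Longrightarrow> {v, u} \<in> E \<Longrightarrow> c u \<noteq> i" by blast
    show ?thesis
      unfolding colourable_def fst_conv snd_conv
    proof (intro exI[of _ "c(v := i)"] conjI ballI impI)
      show "c(v := i) \<in> S \<rightarrow> {..<d}" using c(1) i(1) by auto
    next
      fix x y assume xy: "x \<in> S" "y \<in> S" "{x, y} \<in> E"
      show "(c(v := i)) x \<noteq> (c(v := i)) y"
      proof (cases "x = v")
        case True
        hence "y \<noteq> v" using xy less.prems(2)[of v] by auto
        thus ?thesis using True i(2)[of y] xy by auto
      next
        case False
        thus ?thesis using xy i(2)[of x] c(2)[of x y] by (auto simp: insert_commute)
      qed
    qed
  qed
qed

lemma handshake:
  assumes "finite T" "F \<subseteq> pairs_of T"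
  shows "(\<Sum>v\<in>T. card {u \<in> T. {v, u} \<in> F}) = 2 * card F"
proof -
  have finF: "finite F" using assms finite_pairs_of finite_subset by blast
  have deg: "card {u \<in> T. {v, u} \<in> F} = card {e \<in> F. v \<in> e}" if "v \<in> T" for v
  proof (rule bij_betw_same_card[of "\<lambda>u. {v, u}"], rule bij_betw_imageI)
    show "inj_on (\<lambda>u. {v, u}) {u \<in> T. {v, u} \<in> F}"
      by (auto simp: inj_on_def doubleton_eq_iff)
    show "(\<lambda>u. {v, u}) ` {u \<in> T. {v, u} \<in> F} = {e \<in> F. v \<in> e}"
    proof (intro set_eqI iffI)
      fix e assume e: "e \<in> {e \<in> F. v \<in> e}"
      then obtain a b where "e = {a, b}" "a \<in> T" "b \<in> T" "v = a \<or> v = b"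
        using assms(2) by (force simp: pairs_of_def card_2_iff)
      then obtain u where "e = {v, u}" "u \<in> T" by (metis insert_commute)
      thus "e \<in> (\<lambda>u. {v, u}) ` {u \<in> T. {v, u} \<in> F}" using e by blast
    qed auto
  qed
  have "(\<Sum>v\<in>T. card {u \<in> T. {v, u} \<in> F}) = (\<Sum>v\<in>T. \<Sum>e | e \<in> F \<and> v \<in> e. 1)"
    using deg by simp
  also have "\<dots> = (\<Sum>e\<in>F. \<Sum>v | v \<in> T \<and> v \<in> e. 1)"
    using assms(1) finF by (rule sum.swap_restrict)
  also have "\<dots> = (\<Sum>e\<in>F. 2)"
  proof (rule sum.cong[OF refl])
    fix e assume "e \<in> F"
    hence "{v. v \<in> T \<and> v \<in> e} = e" "card e = 2" using assms(2) by (auto simp: pairs_of_def)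
    thus "(\<Sum>v | v \<in> T \<and> v \<in> e. 1) = (2 :: nat)" by simp
  qed
  finally show ?thesis by simp
qed

text \<open>Fewer than h * card T edges give average degree below 2 * h, so every nonempty T has a
  vertex of degree below 2 * h. The condition on \<open>E \<inter> Pow S\<close> excludes
  loops.\<close>

lemma colourable_if_sparse:
  assumes fin: "finite S" and E: "E \<inter> Pow S \<subseteq> pairs_of S"
    and sparse: "\<And>T. T \<subseteq> S \<Longrightarrow> T \<noteq> {} \<Longrightarrow> card (E \<inter> pairs_of T) < h * card T"
  shows "colourable (S, E) (2 * h)"
proof (rule colourable_if_degenerate[OF fin])
  show "{v} \<notin> E" if "v \<in> S" for v using E that by (auto simp: pairs_of_def)
next
  fix T assume T: "T \<subseteq> S" "T \<noteq> {}"
  have finT: "finite T" using T fin finite_subset by blast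
  show "\<exists>v\<in>T. card {u \<in> T. {v, u} \<in> E} < 2 * h"
  proof (rule ccontr)
    assume *: "\<not> ?thesis"
    have "2 * h * card T = (\<Sum>v\<in>T. 2 * h)" by simp
    also have "\<dots> \<le> (\<Sum>v\<in>T. card {u \<in> T. {v, u} \<in> E})"
      using * by (intro sum_mono) auto
    also have "\<dots> = (\<Sum>v\<in>T. card {u \<in> T. {v, u} \<in> E \<inter> pairs_of T})"
    proof (intro sum.cong arg_cong[of _ _ card] Collect_cong refl)
      fix v u assume "v \<in> T"
      thus "(u \<in> T \<and> {v, u} \<in> E) = (u \<in> T \<and> {v, u} \<in> E \<inter> pairs_of T)"
        using E T by (auto simp: pairs_of_def)
    qed
    also have "\<dots> = 2 * card (E \<inter> pairs_of T)" by (rule handshake[OF finT]) auto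
    finally show False using sparse[OF T] by simp
  qed
qed

lemma card_le_colours_times_independence:
  assumes "finite V" "colourable (V, E) c"
    and "\<And>I. I \<subseteq> V \<Longrightarrow> independent_set E I \<Longrightarrow> card I \<le> r"
  shows "card V \<le> c * r"
proof -
  from heavy_colour_class[OF assms(1,2), of "\<lambda>_. 1"] obtain I
    where I: "I \<subseteq> V" "independent_set E I" "real (card V) \<le> real c * real (card I)"
    by auto
  hence "card V \<le> c * card I" by (simp flip: of_nat_mult)
  also have "\<dots> \<le> c * r" using assms(3) I by simp
  finally show ?thesis .
qed

lemma independent_set_iff_independent_in:
  assumes "I \<subseteq> V"
  shows "independent_set {e \<in> pairs_of V. X e} I \<longleftrightarrow> independent_in X I"
proof
  assume *: "independent_in X I"
  show "independent_set {e \<in> pairs_of V. X e} I"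
    unfolding independent_set_def
  proof (intro ballI notI)
    fix u v assume uv: "u \<in> I" "v \<in> I" "{u, v} \<in> {e \<in> pairs_of V. X e}"
    hence "u \<noteq> v" by (auto simp: pairs_of_def)
    thus False using uv * pair_in_pairs_of[of u I v] by (auto simp: independent_in_def)
  qed
next
  assume *: "independent_set {e \<in> pairs_of V. X e} I"
  show "independent_in X I"
    unfolding independent_in_def
  proof
    fix e assume e: "e \<in> pairs_of I"
    then obtain u v where "e = {u, v}" "u \<in> I" "v \<in> I"
      by (auto simp: pairs_of_def card_2_iff)
    thus "\<not> X e" using * e pairs_of_mono[OF assms] by (auto simp: independent_set_def)
  qed
qed

text \<open>Isolates the three properties of the edge indicator that have to hold with high
  probability. Large sets are tested at exactly s vertices, since bigger ones contain such a set;
  this keeps the union bound to one size.\<close>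

lemma graph_parameters_deterministic:
  fixes X :: "'a set \<Rightarrow> bool" and V :: "'a set"
  defines "G \<equiv> (V, {e \<in> pairs_of V. X e})"
  assumes V: "finite V" "V \<noteq> {}" and k: "k \<ge> 1" and h: "h \<ge> 1"
    and no_large: "\<not> has_independent X V r"
    and large: "\<And>S. S \<subseteq> V \<Longrightarrow> card S = s \<Longrightarrow> has_independent X S k"
    and sparse: "\<And>T. T \<subseteq> V \<Longrightarrow> T \<noteq> {} \<Longrightarrow> card T < s \<Longrightarrow> card {e \<in> pairs_of T. X e} < h * card T"
    and K: "real (card V) / real k + real (2 * h) * ln (real (card V)) \<le> real K"
  shows "chromatic_number G \<le> paintability G" "paintability G \<le> Suc K"
    "card V \<le> chromatic_number G * r"
proof -
  let ?E = "{e \<in> pairs_of V. X e}"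
  have paint: "paintable G (Suc K)"
    unfolding G_def
  proof (rule paintable_if_large_small[OF V k _ _ _ K, where \<sigma> = "real s"])
    show "2 \<le> 2 * h" using h by simp
  next
    fix S assume S: "S \<subseteq> V" "real s \<le> real (card S)"
    then obtain S' where S': "S' \<subseteq> S" "card S' = s"
      by (metis obtain_subset_with_card_n of_nat_le_iff)
    then obtain I where "I \<subseteq> S'" "card I = k" "independent_in X I"
      using large[of S'] S by (auto simp: has_independent_def)
    thus "\<exists>I\<subseteq>S. independent_set ?E I \<and> k \<le> card I"
      using S S' independent_set_iff_independent_in[of I V X]
      by (intro exI[of _ I]) auto
  next
    fix S assume S: "S \<subseteq> V" "real (card S) < real s"
    have finS: "finite S" using S V finite_subset by blast
    show "colourable (S, ?E) (2 * h)"
    proof (rule colourable_if_sparse[OF finS])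
      show "?E \<inter> Pow S \<subseteq> pairs_of S" by (auto simp: pairs_of_def)
    next
      fix T assume T: "T \<subseteq> S" "T \<noteq> {}"
      hence "card T < s" using S card_mono[OF finS T(1)] by simp
      moreover have "?E \<inter> pairs_of T = {e \<in> pairs_of T. X e}"
        using T S by (auto simp: pairs_of_def)
      ultimately show "card (?E \<inter> pairs_of T) < h * card T" using sparse[of T] T S by auto
    qed
  qed
  show "chromatic_number G \<le> paintability G"
    by (rule chromatic_number_le_paintability[OF paint])
  show "paintability G \<le> Suc K"
    by (rule paintability_le[OF paint])
  have "colourable G (chromatic_number G)"
    unfolding chromatic_number_def
    by (rule LeastI[where P = "colourable G"]) (rule colourable_if_paintable[OF paint])
  thus "card V \<le> chromatic_number G * r"
  proof (intro card_le_colours_times_independence[OF V(1)])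
    fix I assume I: "I \<subseteq> V" "independent_set ?E I"
    show "card I \<le> r"
    proof (rule ccontr)
      assume "\<not> card I \<le> r"
      then obtain J where J: "J \<subseteq> I" "card J = r" "finite J"
        by (metis linorder_not_le nle_le obtain_subset_with_card_n)
      have "independent_in X J"
        using I J pairs_of_mono[OF J(1)] independent_set_iff_independent_in[of I V X]
        by (auto simp: independent_in_def)
      thus False using no_large J I by (auto simp: has_independent_def)
    qed
  qed (simp add: G_def)
qed

section \<open>Union bounds for the three bad events\<close>

lemma binomial_le_exp_power:
  assumes "r \<ge> 1"
  shows "real (n choose r) \<le> (exp 1 * real n / real r) ^ r"
proof -
  \<comment> \<open>A single term of the exponential series; it amounts to r! \<ge> (r /
    e)^r.\<close>
  have "real r ^ r / fact r \<le> exp (real r)"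
  proof -
    obtain t where "exp (real r) = (\<Sum>m<Suc r. real r ^ m / fact m) + (exp t / fact (Suc r)) * real r ^ Suc r"
      using Maclaurin_exp_le[of "real r" "Suc r"] by blast
    moreover have "real r ^ r / fact r \<le> (\<Sum>m<Suc r. real r ^ m / fact m)"
      by (rule member_le_sum[where f = "\<lambda>m. real r ^ m / fact m"]) auto
    moreover have "(exp t / fact (Suc r)) * real r ^ Suc r \<ge> 0" by (intro mult_nonneg_nonneg) auto
    ultimately show ?thesis by linarith
  qed
  hence 1: "1 \<le> exp (real r) * fact r / real r ^ r"
    using assms by (simp add: field_simps)
  have "real (n choose r) \<le> real (n choose r) * (exp (real r) * fact r / real r ^ r)"
    using mult_left_mono[OF 1, of "real (n choose r)"] by simp
  also have "\<dots> = real ((n choose r) * fact r) * exp (real r) / real r ^ r"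
    by simp
  also have "\<dots> \<le> real (n ^ r) * exp (real r) / real r ^ r"
    by (intro divide_right_mono mult_right_mono of_nat_mono binomial_fact_pow) auto
  also have "\<dots> = (exp 1 * real n / real r) ^ r"
    by (simp add: power_divide power_mult_distrib exp_of_nat_mult[symmetric])
  finally show ?thesis .
qed

lemma prob_Ex_le:
  assumes "finite F"
  shows "measure_pmf.prob M {x. \<exists>s\<in>F. P s x} \<le> (\<Sum>s\<in>F. measure_pmf.prob M {x. P s x})"
proof -
  have "{x. \<exists>s\<in>F. P s x} = (\<Union>s\<in>F. {x. P s x})" by blast
  thus ?thesis using assms by (simp add: measure_UNION_le)
qed

lemma prob_Ex_le_bound:
  assumes "finite F" "\<And>s. s \<in> F \<Longrightarrow> measure_pmf.prob M {x. P s x} \<le> b"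
  shows "measure_pmf.prob M {x. \<exists>s\<in>F. P s x} \<le> real (card F) * b"
proof -
  have "(\<Sum>s\<in>F. measure_pmf.prob M {x. P s x}) \<le> real (card F) * b"
    using assms(2) by (intro sum_bounded_above)
  with prob_Ex_le[OF assms(1)] show ?thesis by (rule order_trans)
qed

lemma prob_has_independent_le:
  assumes "finite V" "pairs_of V \<subseteq> D" "finite D" "0 \<le> p" "p \<le> 1"
  shows "measure_pmf.prob (edge_pmf D p) {X. has_independent X V r} \<le>
    real (card V choose r) * (1 - p) ^ (r choose 2)"
proof -
  have "{X. has_independent X V r} = {X. \<exists>I\<in>{I. I \<subseteq> V \<and> card I = r}. \<forall>e\<in>pairs_of I. \<not> X e}"
    using assms(1) by (auto simp: has_independent_def independent_in_def intro: finite_subset)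
  moreover have "measure_pmf.prob (edge_pmf D p) {X. \<exists>I\<in>{I. I \<subseteq> V \<and> card I = r}. \<forall>e\<in>pairs_of I. \<not> X e}
      \<le> real (card {I. I \<subseteq> V \<and> card I = r}) * (1 - p) ^ (r choose 2)"
  proof (rule prob_Ex_le_bound)
    fix I assume I: "I \<in> {I. I \<subseteq> V \<and> card I = r}"
    hence "finite I" using assms finite_subset by blast
    thus "measure_pmf.prob (edge_pmf D p) {X. \<forall>e\<in>pairs_of I. \<not> X e} \<le> (1 - p) ^ (r choose 2)"
      using I assms pairs_of_mono[of I V]
      by (subst prob_edges_absent) (auto simp: card_pairs_of)
  qed (use assms in auto)
  ultimately show ?thesis using assms(1) by (simp add: n_subsets)
qed

text \<open>With t = \<open>card T\<close>, the expected number of sets of h * t pairs in T that are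
  all edges is at most (e * t * p / (2 * h)) ^ (h * t), and the last assumption makes the base at
  most 1 / e.\<close>

lemma prob_dense_subset_le:
  assumes "finite T" "T \<noteq> {}" "pairs_of T \<subseteq> D" "finite D" "0 \<le> p" "p \<le> 1" "h \<ge> 1"
    and "(exp 1)\<^sup>2 * real (card T) * p \<le> 2 * real h"
  shows "measure_pmf.prob (edge_pmf D p) {X. h * card T \<le> card {e \<in> pairs_of T. X e}} \<le>
    exp (- real (h * card T))"
proof -
  let ?t = "card T" let ?m = "h * card T"
  have t: "?t \<ge> 1" using assms by (simp add: Suc_le_eq card_gt_0_iff)
  have m: "?m \<ge> 1" using t assms by simp
  let ?\<F> = "{F. F \<subseteq> pairs_of T \<and> card F = ?m}"
  have finP: "finite (pairs_of T)" using assms(1) by (rule finite_pairs_of)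
  have "measure_pmf.prob (edge_pmf D p) {X. ?m \<le> card {e \<in> pairs_of T. X e}} \<le>
      measure_pmf.prob (edge_pmf D p) {X. \<exists>F\<in>?\<F>. \<forall>e\<in>F. X e}"
  proof (intro measure_pmf.finite_measure_mono subsetI)
    fix X assume "X \<in> {X. ?m \<le> card {e \<in> pairs_of T. X e}}"
    then obtain F where "F \<subseteq> {e \<in> pairs_of T. X e}" "card F = ?m"
      by (auto elim: obtain_subset_with_card_n)
    thus "X \<in> {X. \<exists>F\<in>?\<F>. \<forall>e\<in>F. X e}" by blast
  qed auto
  also have "\<dots> \<le> real (card ?\<F>) * p ^ ?m"
    using assms finP by (intro prob_Ex_le_bound) (auto simp: prob_edges_present)
  also have "card ?\<F> = (?t choose 2) choose ?m"
    using finP assms(1) by (simp add: n_subsets card_pairs_of)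
  also have "real ((?t choose 2) choose ?m) * p ^ ?m \<le> (exp 1 * real (?t choose 2) / real ?m) ^ ?m * p ^ ?m"
    using assms m by (intro mult_right_mono binomial_le_exp_power) auto
  also have "\<dots> = (exp 1 * real (?t choose 2) / real ?m * p) ^ ?m"
    by (simp only: power_mult_distrib)
  also have "\<dots> \<le> exp (-1) ^ ?m"
  proof (rule power_mono)
    have "real (?t choose 2) \<le> real ?t * real ?t / 2"
    proof -
      have "2 * (?t choose 2) \<le> ?t * (?t - 1)" unfolding choose_two by simp
      also have "\<dots> \<le> ?t * ?t" by (intro mult_left_mono) auto
      finally have "real (2 * (?t choose 2)) \<le> real (?t * ?t)" by (rule of_nat_mono)
      thus ?thesis by simp
    qed
    hence "exp 1 * real (?t choose 2) / real ?m * p \<le> exp 1 * (real ?t * real ?t / 2) / real ?m * p"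
      using assms by (intro mult_right_mono divide_right_mono mult_left_mono) auto
    also have "\<dots> = exp 1 * real ?t * p / (2 * real h)"
      using t by (simp add: field_simps)
    also have "\<dots> \<le> exp (-1)"
    proof -
      have "exp 1 * (exp 1 * real ?t * p) \<le> 2 * real h"
        using assms(8) by (simp add: power2_eq_square mult_ac)
      thus ?thesis using assms(7) by (simp add: exp_minus field_simps)
    qed
    finally show "exp 1 * real (?t choose 2) / real ?m * p \<le> exp (-1)" .
  qed (use assms in auto)
  also have "\<dots> = exp (- real ?m)" by (simp add: exp_of_nat_mult[symmetric])
  finally show ?thesis .
qed

text \<open>There are at most n^t sets of size t, and h \<ge> 3 * ln n gives each a probability of
  at most n^(-3 t). What is left, n^(-2 t) \<le> n^(-2), is summed over at most n sizes.\<close>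

lemma prob_dense_small_subset_le:
  assumes "finite V" "card V = n" "n \<ge> 1" "pairs_of V \<subseteq> D" "finite D" "0 \<le> p" "p \<le> 1" "h \<ge> 1"
    and "\<And>t. t < s \<Longrightarrow> (exp 1)\<^sup>2 * real t * p \<le> 2 * real h" and "3 * ln (real n) \<le> real h"
  shows "measure_pmf.prob (edge_pmf D p)
    {X. \<exists>T\<subseteq>V. T \<noteq> {} \<and> card T < s \<and> h * card T \<le> card {e \<in> pairs_of T. X e}} \<le> 1 / real n"
proof -
  let ?P = "\<lambda>T X. h * card T \<le> card {e \<in> pairs_of T. X e}"
  let ?F = "\<lambda>t. {T. T \<subseteq> V \<and> card T = t}"
  have "measure_pmf.prob (edge_pmf D p)
      {X. \<exists>T\<subseteq>V. T \<noteq> {} \<and> card T < s \<and> ?P T X} \<le>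
    measure_pmf.prob (edge_pmf D p) {X. \<exists>t\<in>{1..n} \<inter> {..<s}. \<exists>T\<in>?F t. ?P T X}"
  proof (intro measure_pmf.finite_measure_mono subsetI)
    fix X assume "X \<in> {X. \<exists>T\<subseteq>V. T \<noteq> {} \<and> card T < s \<and> ?P T X}"
    then obtain T where T: "T \<subseteq> V" "T \<noteq> {}" "card T < s" "?P T X" by blast
    have "finite T" using T(1) assms(1) finite_subset by blast
    hence "card T \<ge> 1" "card T \<le> n"
      using T assms(1,2) card_mono[of V T] by (auto simp: Suc_le_eq card_gt_0_iff)
    thus "X \<in> {X. \<exists>t\<in>{1..n} \<inter> {..<s}. \<exists>T\<in>?F t. ?P T X}" using T by auto
  qed auto
  also have "\<dots> \<le> real (card ({1..n} \<inter> {..<s})) * (1 / real n ^ 2)"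
  proof (rule prob_Ex_le_bound)
    fix t assume t: "t \<in> {1..n} \<inter> {..<s}"
    have "measure_pmf.prob (edge_pmf D p) {X. \<exists>T\<in>?F t. ?P T X} \<le> real (card (?F t)) * exp (- real (h * t))"
    proof (rule prob_Ex_le_bound)
      fix T assume T: "T \<in> ?F t"
      have "finite T" "T \<noteq> {}" "pairs_of T \<subseteq> D"
        using T t assms(1,4) pairs_of_mono[of T V] by (auto intro: finite_subset)
      thus "measure_pmf.prob (edge_pmf D p) {X. ?P T X} \<le> exp (- real (h * t))"
        using T t assms prob_dense_subset_le[of T D p h] by auto
    qed (use assms in auto)
    also have "card (?F t) = n choose t" using assms by (simp add: n_subsets)
    also have "real (n choose t) * exp (- real (h * t)) \<le> real (n ^ t) * (1 / real n ^ (3 * t))"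
    proof (intro mult_mono of_nat_mono)
      show "n choose t \<le> n ^ t" using t by (intro binomial_le_pow) auto
      have "exp (- real (h * t)) \<le> exp (- (3 * ln (real n) * real t))"
        using mult_right_mono[OF assms(10), of "real t"] by simp
      also have "\<dots> = 1 / exp (real (3 * t) * ln (real n))" by (simp add: exp_minus field_simps)
      also have "exp (real (3 * t) * ln (real n)) = real n ^ (3 * t)"
        using assms(3) by (simp only: exp_of_nat_mult) simp
      finally show "exp (- real (h * t)) \<le> 1 / real n ^ (3 * t)" .
    qed auto
    also have "\<dots> = 1 / real n ^ (2 * t)"
    proof -
      have "real n ^ (3 * t) = real n ^ t * real n ^ (2 * t)" by (simp flip: power_add)
      thus ?thesis using assms(3) by simp
    qed
    also have "\<dots> \<le> 1 / real n ^ 2"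
      using assms(3) t by (intro divide_left_mono power_increasing mult_pos_pos) auto
    finally show "measure_pmf.prob (edge_pmf D p) {X. \<exists>T\<in>?F t. ?P T X} \<le> 1 / real n ^ 2" .
  qed auto
  also have "\<dots> \<le> real n * (1 / real n ^ 2)"
    using card_mono[of "{1..n}" "{1..n} \<inter> {..<s}"] by (intro mult_right_mono) auto
  also have "\<dots> = 1 / real n" using assms(3) by (simp add: power2_eq_square)
  finally show ?thesis .
qed

lemma prob_subset_without_independent_le:
  fixes p \<theta> M :: real
  assumes p: "0 < p" "p < 1" and \<theta>: "\<theta> \<ge> 0" and M: "M > 0" and k: "k \<ge> 1"
    and cond: "1 / p - (1 - p) ^ k * M / 2 \<le> - \<theta> * real k"
    and V: "finite V" "pairs_of V \<subseteq> D" "finite D"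
  shows "measure_pmf.prob (edge_pmf D p) {X. \<exists>S\<subseteq>V. card S = s \<and> \<not> has_independent X S k} \<le>
    real (card V choose s) * exp (- \<theta> * (real s - M))"
proof -
  have "measure_pmf.prob (edge_pmf D p) {X. \<exists>S\<in>{S. S \<subseteq> V \<and> card S = s}. \<not> has_independent X S k} \<le>
      real (card {S. S \<subseteq> V \<and> card S = s}) * exp (- \<theta> * (real s - M))"
  proof (rule prob_Ex_le_bound)
    fix S assume S: "S \<in> {S. S \<subseteq> V \<and> card S = s}"
    hence "finite S" "pairs_of S \<subseteq> D" using V pairs_of_mono[of S V] by (auto intro: finite_subset)
    thus "measure_pmf.prob (edge_pmf D p) {X. \<not> has_independent X S k} \<le> exp (- \<theta> * (real s - M))"
      using prob_no_independent[OF p \<theta> M k cond, of S D] S V by auto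
  qed (use V in auto)
  thus ?thesis using V by (simp add: n_subsets Bex_def conj_assoc)
qed

text \<open>The bound for fixed n with all parameters free. Its error terms belong, in this order,
  to the assumptions \<open>no_large\<close>, \<open>large\<close> and \<open>sparse\<close> of
  \<open>graph_parameters_deterministic\<close>.\<close>

lemma prob_gnp_parameters_ge:
  fixes p \<theta> M :: real
  assumes n: "n \<ge> 1" and p: "0 < p" "p < 1" and \<theta>: "\<theta> \<ge> 0" and M: "M > 0" and k: "k \<ge> 1" and h: "h \<ge> 1"
    and cond: "1 / p - (1 - p) ^ k * M / 2 \<le> - \<theta> * real k"
    and small: "\<And>t. t < s \<Longrightarrow> (exp 1)\<^sup>2 * real t * p \<le> 2 * real h" and h': "3 * ln (real n) \<le> real h"
    and K: "real n / real k + real (2 * h) * ln (real n) \<le> real K"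
  shows "measure_pmf.prob (gnp n p) {G. chromatic_number G \<le> paintability G \<and>
      paintability G \<le> Suc K \<and> n \<le> chromatic_number G * r} \<ge>
    1 - (real (n choose r) * (1 - p) ^ (r choose 2) + real (n choose s) * exp (- \<theta> * (real s - M)) + 1 / real n)"
proof -
  define V where "V = {1..n}"
  have V: "finite V" "V \<noteq> {}" "card V = n" using n by (auto simp: V_def)
  let ?D = "pairs_of V"
  have D: "finite ?D" by (rule finite_pairs_of[OF V(1)])
  let ?Q = "\<lambda>G. chromatic_number G \<le> paintability G \<and> paintability G \<le> Suc K \<and> n \<le> chromatic_number G * r"
  let ?G = "\<lambda>X. (V, {e \<in> ?D. X e})"
  let ?B1 = "{X. has_independent X V r}"
  let ?B2 = "{X. \<exists>S\<subseteq>V. card S = s \<and> \<not> has_independent X S k}"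
  let ?B3 = "{X. \<exists>T\<subseteq>V. T \<noteq> {} \<and> card T < s \<and> h * card T \<le> card {e \<in> pairs_of T. X e}}"
  let ?P = "measure_pmf.prob (edge_pmf ?D p)"
  have "{X. \<not> ?Q (?G X)} \<subseteq> ?B1 \<union> ?B2 \<union> ?B3"
  proof
    fix X assume X: "X \<in> {X. \<not> ?Q (?G X)}"
    show "X \<in> ?B1 \<union> ?B2 \<union> ?B3"
    proof (rule ccontr)
      assume "X \<notin> ?B1 \<union> ?B2 \<union> ?B3"
      hence *: "\<not> has_independent X V r"
        "\<And>S. S \<subseteq> V \<Longrightarrow> card S = s \<Longrightarrow> has_independent X S k"
        "\<And>T. T \<subseteq> V \<Longrightarrow> T \<noteq> {} \<Longrightarrow> card T < s \<Longrightarrow> card {e \<in> pairs_of T. X e} < h * card T"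
        by (auto simp: not_le)
      have "real (card V) / real k + real (2 * h) * ln (real (card V)) \<le> real K"
        using K V(3) by simp
      from graph_parameters_deterministic[where s = s, OF V(1,2) k h *(1) *(2) *(3) this]
      show False using X V(3) by simp
    qed
  qed
  hence "?P {X. \<not> ?Q (?G X)} \<le> ?P (?B1 \<union> ?B2 \<union> ?B3)"
    by (intro measure_pmf.finite_measure_mono) auto
  also have "\<dots> \<le> ?P ?B1 + ?P ?B2 + ?P ?B3"
    by (intro order_trans[OF measure_Un_le] add_mono measure_Un_le order.refl) auto
  also have "\<dots> \<le> real (n choose r) * (1 - p) ^ (r choose 2) + real (n choose s) * exp (- \<theta> * (real s - M)) + 1 / real n"
    using prob_has_independent_le[OF V(1) order.refl D, of p r]
      prob_subset_without_independent_le[OF p \<theta> M k cond V(1) order.refl D, of s]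
      prob_dense_small_subset_le[OF V(1,3) n order.refl D _ _ h small h'] p V(3)
    by (intro add_mono) auto
  finally have "?P {X. \<not> ?Q (?G X)} \<le> \<dots>" .
  moreover have "measure_pmf.prob (gnp n p) {G. ?Q G} = ?P {X. ?Q (?G X)}"
    by (simp add: gnp_def vertex_pairs_def pairs_of_def V_def vimage_def)
  moreover have "?P {X. ?Q (?G X)} = 1 - ?P {X. \<not> ?Q (?G X)}"
    using measure_pmf.prob_compl[of "{X. \<not> ?Q (?G X)}" "edge_pmf ?D p"]
    by (simp add: Compl_eq_Diff_UNIV[symmetric] Collect_neg_eq[symmetric] del: de_Morgan_conj)
  ultimately show ?thesis by linarith
qed

lemma aas_mono:
  assumes "aas p P" "\<forall>\<^sub>F n in sequentially. \<forall>G. P n G \<longrightarrow> Q n G"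
  shows "aas p Q"
  unfolding aas_def
proof (rule tendsto_sandwich)
  show "\<forall>\<^sub>F n in sequentially. measure_pmf.prob (gnp n (p n)) {G. P n G} \<le> measure_pmf.prob (gnp n (p n)) {G. Q n G}"
    using assms(2) by eventually_elim (auto intro!: measure_pmf.finite_measure_mono)
  show "\<forall>\<^sub>F n in sequentially. measure_pmf.prob (gnp n (p n)) {G. Q n G} \<le> 1" by simp
qed (use assms(1) in \<open>auto simp: aas_def\<close>)

section \<open>The sparse regime\<close>

locale sparse_regime =
  fixes \<epsilon> :: real and p :: "nat \<Rightarrow> real"
  assumes eps: "\<epsilon> > 0"
    and p01: "\<And>n. p n \<in> {0..1}"
    and p_lower: "\<forall>\<^sub>F n in sequentially. ln (real n) powr (2 + \<epsilon>) / real n \<le> p n"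
    and p_upper: "p \<in> O(\<lambda>n. ln (ln (real n)) powr (1/3) * (ln (real n))\<^sup>2 * real n powr (-1/3))"
begin

text \<open>Presented sets count as large from size \<open>s0\<close> on. Up to its lower-order corrections, \<open>y / p\<close> is
  \<open>ln (s0 * p) / p\<close>, the size of a greedy independent set among \<open>s0\<close> vertices; the cubic power of \<open>l\<close>
  thus given away makes the failure probability small enough for the union bound over all sets.\<close>

definition L :: "nat \<Rightarrow> real" where "L n = ln (real n)"
definition x :: "nat \<Rightarrow> real" where "x n = real n * p n"
definition l :: "nat \<Rightarrow> real" where "l n = ln (x n)"
definition w :: "nat \<Rightarrow> real" where "w n = l n - ln (L n)"
definition y :: "nat \<Rightarrow> real" where "y n = w n - 5 * ln (l n)"
definition s0 :: "nat \<Rightarrow> real" where "s0 n = real n / (L n * (l n)\<^sup>2)"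
definition s :: "nat \<Rightarrow> nat" where "s n = nat \<lceil>s0 n\<rceil>"
definition k :: "nat \<Rightarrow> nat" where "k n = nat \<lfloor>y n / p n\<rfloor>"
text \<open>The first summand gives e^2 * t * p \<le> 2 * h for t \<le> s0, as e^2 < 10; the second
  pays for the union bound over small sets.\<close>

definition h :: "nat \<Rightarrow> nat" where "h n = nat \<lceil>5 * s0 n * p n + 3 * L n\<rceil>"
text \<open>The added 1 offsets the - 1 in r * (r - 1) / 2, so that (r - 1) * p / 2 \<ge> l.\<close>

definition r :: "nat \<Rightarrow> nat" where "r n = nat \<lceil>2 * l n / p n\<rceil> + 1"
definition K :: "nat \<Rightarrow> nat" where "K n = nat \<lceil>real n / real (k n) + real (2 * h n) * ln (real n)\<rceil>"

section \<open>Growth of the parameters\<close>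

lemma L_at_top: "filterlim L at_top sequentially"
  unfolding L_def by real_asymp

lemma x_lower: "\<forall>\<^sub>F n in sequentially. L n powr (2 + \<epsilon>) \<le> x n"
  using p_lower eventually_gt_at_top[of 0]
  by eventually_elim (simp add: L_def x_def field_simps)

lemma eventually_L_gt: "\<forall>\<^sub>F n in sequentially. L n > c"
  using L_at_top by (auto simp: filterlim_at_top_dense)

lemma L_le_x: "\<forall>\<^sub>F n in sequentially. L n \<le> x n"
  using x_lower eventually_L_gt[of 1]
proof eventually_elim
  case (elim n)
  have "L n powr 1 \<le> L n powr (2 + \<epsilon>)" using elim eps by (intro powr_mono) auto
  with elim show ?case by simp
qed

lemma x_at_top: "filterlim x at_top sequentially"
  using L_at_top L_le_x by (rule filterlim_at_top_mono)

lemma l_at_top: "filterlim l at_top sequentially"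
  unfolding l_def by (rule filterlim_compose[OF ln_at_top x_at_top])

lemma eventually_l_gt: "\<forall>\<^sub>F n in sequentially. l n > c"
  using l_at_top by (auto simp: filterlim_at_top_dense)

lemma eventually_basic:
  "\<forall>\<^sub>F n in sequentially. n \<ge> 1 \<and> 0 < p n \<and> L n > 1 \<and> x n > 1 \<and> l n \<le> L n \<and> L n \<le> x n \<and>
     0 < ln (L n) \<and> (2 + \<epsilon>) * ln (L n) \<le> l n"
  using x_lower L_le_x eventually_L_gt[of 1] eventually_ge_at_top[of 1]
proof eventually_elim
  case (elim n)
  have x: "x n > 1" using elim by linarith
  have "p n \<noteq> 0" using x by (auto simp: x_def)
  hence p: "p n > 0" using p01[of n] by auto
  have "x n \<le> real n" using p01[of n] by (simp add: x_def mult_left_le)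
  hence "l n \<le> L n" using x by (simp add: l_def L_def)
  moreover have "(2 + \<epsilon>) * ln (L n) \<le> l n"
  proof -
    have "ln (L n powr (2 + \<epsilon>)) \<le> ln (x n)" using elim x by (intro ln_mono) auto
    thus ?thesis using elim by (simp add: l_def ln_powr)
  qed
  ultimately show ?case using elim x p by simp
qed

text \<open>The upper bound on p enters here. As y \<le> l \<le> L, it keeps p * y bounded, so that
  (1 - p)^k is at least a constant times exp (- y).\<close>

lemma pL_tendsto: "(\<lambda>n. p n * L n) \<longlonglongrightarrow> 0"
proof -
  let ?g = "\<lambda>n::nat. ln (ln (real n)) powr (1/3) * (ln (real n))\<^sup>2 * real n powr (-1/3)"
  have "(\<lambda>n. p n * L n) \<in> O(\<lambda>n. ?g n * L n)"
    using p_upper by (intro landau_o.big.mult) auto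
  moreover have "(\<lambda>n. ?g n * L n) \<in> o(\<lambda>_. 1)"
    unfolding L_def by real_asymp
  ultimately have "(\<lambda>n. p n * L n) \<in> o(\<lambda>_. 1)" by (rule landau_o.big_small_trans)
  from smalloD_tendsto[OF this] show ?thesis by simp
qed

lemma p_small: "\<forall>\<^sub>F n in sequentially. p n * L n < 1/4 \<and> p n < 1/4"
  using order_tendstoD(2)[OF pL_tendsto, of "1/4", simplified] eventually_basic
proof eventually_elim
  case (elim n)
  hence "p n * 1 \<le> p n * L n" by (intro mult_left_mono) auto
  with elim show ?case by linarith
qed

text \<open>The exponent of ln n in the lower bound on np exceeds 2, so ln (L n) is at most half of
  l n. The resulting 2 * l / w \<le> 4 is the origin of the constant 4 in the theorem.\<close>

lemma w_bounds: "\<forall>\<^sub>F n in sequentially. l n / 2 \<le> w n \<and> w n \<le> l n"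
  using eventually_basic
proof eventually_elim
  case (elim n)
  have "2 * ln (L n) \<le> (2 + \<epsilon>) * ln (L n)" using elim eps by (intro mult_right_mono) auto
  hence "2 * ln (L n) \<le> l n" using elim by linarith
  thus ?case using elim by (simp add: w_def)
qed

lemma ln_l_over_l: "(\<lambda>n. ln (l n) / l n) \<longlonglongrightarrow> 0"
  by (rule filterlim_compose[OF _ l_at_top]) real_asymp

text \<open>Here \<epsilon> is spent: L^2 \<le> x^(2 / (2 + \<epsilon>)) leaves a negative power of
  x against the logarithm l.\<close>

lemma L2_l_over_x: "(\<lambda>n. (L n)\<^sup>2 * l n / x n) \<longlonglongrightarrow> 0"
proof (rule tendsto_sandwich)
  show "\<forall>\<^sub>F n in sequentially. 0 \<le> (L n)\<^sup>2 * l n / x n"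
    using eventually_basic eventually_l_gt[of 0] by eventually_elim auto
  define c where "c = \<epsilon> / (2 + \<epsilon>)"
  have c: "c > 0" using eps by (simp add: c_def)
  have "((\<lambda>t::real. ln t * t powr (-c)) \<longlongrightarrow> 0) at_top"
    using c by real_asymp
  thus "(\<lambda>n. ln (x n) * x n powr (-c)) \<longlonglongrightarrow> 0"
    by (rule filterlim_compose[OF _ x_at_top])
  show "\<forall>\<^sub>F n in sequentially. (L n)\<^sup>2 * l n / x n \<le> ln (x n) * x n powr (-c)"
    using x_lower eventually_basic eventually_l_gt[of 0]
  proof eventually_elim
    case (elim n)
    have "(L n)\<^sup>2 = (L n powr (2 + \<epsilon>)) powr (2 / (2 + \<epsilon>))"
    proof -
      have "(2 + \<epsilon>) * (2 / (2 + \<epsilon>)) = 2" using eps by (simp add: field_simps)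
      thus ?thesis using elim by (simp only: powr_powr) simp
    qed
    also have "\<dots> \<le> x n powr (2 / (2 + \<epsilon>))"
      using elim eps by (intro powr_mono2) auto
    also have "2 / (2 + \<epsilon>) = 1 - c" using eps by (simp add: c_def field_simps)
    also have "x n powr (1 - c) = x n * x n powr (-c)"
      using elim by (simp add: powr_diff powr_minus field_simps)
    finally have "(L n)\<^sup>2 * l n \<le> x n * x n powr (-c) * l n"
      using elim by (intro mult_right_mono) auto
    thus ?case using elim by (simp add: l_def field_simps)
  qed
qed auto

lemma y_bounds: "\<forall>\<^sub>F n in sequentially. 1 \<le> y n \<and> y n \<le> l n"
  using order_tendstoD(2)[OF ln_l_over_l, of "1/20", simplified] w_bounds eventually_l_gt[of 4]
proof eventually_elim
  case (elim n)
  have "5 * ln (l n) \<le> l n / 4" using elim by (simp add: field_simps)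
  moreover have "ln (l n) \<ge> 0" using elim by simp
  ultimately show ?case using elim unfolding y_def by linarith
qed

lemma k_bounds:
  "\<forall>\<^sub>F n in sequentially. 1 \<le> k n \<and> real (k n) * p n \<le> y n \<and> y n - p n \<le> real (k n) * p n"
  using y_bounds p_small eventually_basic
proof eventually_elim
  case (elim n)
  have "1 \<le> y n / p n" using elim by (simp add: field_simps)
  hence k: "k n \<ge> 1" "real (k n) \<le> y n / p n" "y n / p n - 1 \<le> real (k n)"
    unfolding k_def by linarith+
  show ?case using k elim by (simp add: field_simps)
qed

lemma r_bounds:
  "\<forall>\<^sub>F n in sequentially. 1 \<le> r n \<and> 2 * l n \<le> real (r n) * p n \<and>
     2 * l n \<le> (real (r n) - 1) * p n \<and> real (r n) * p n \<le> 2 * l n + 2 * p n"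
  using eventually_basic eventually_l_gt[of 0]
proof eventually_elim
  case (elim n)
  have "0 \<le> 2 * l n / p n" using elim by simp
  hence "2 * l n / p n \<le> real (r n) - 1" "real (r n) \<le> 2 * l n / p n + 2"
    unfolding r_def by linarith+
  hence "2 * l n \<le> (real (r n) - 1) * p n" "real (r n) * p n \<le> 2 * l n + 2 * p n"
    using elim by (simp_all add: field_simps)
  moreover have "(real (r n) - 1) * p n \<le> real (r n) * p n" using elim by simp
  moreover have "1 \<le> r n" by (simp add: r_def)
  ultimately show ?case by linarith
qed

section \<open>Vanishing failure probabilities\<close>

lemma s0_times_p: "\<forall>\<^sub>F n in sequentially. s0 n * p n = x n / (L n * (l n)\<^sup>2) \<and> s0 n > 0"
  using eventually_basic eventually_l_gt[of 0]
  by eventually_elim (simp add: s0_def x_def)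

text \<open>This is \<open>cond\<close> for M = s / 2 and \<theta> = l^2 / 16. The term 5 * ln l in
  y is chosen so that exp (- y) * s0 = l^3 / p. The subtracted term is therefore at least l^3 / (8 *
  p); one half of it covers \<theta> * k, as k * p \<le> l, and the other covers 1 / p, as l >
  3.\<close>

lemma greedy_condition:
  "\<forall>\<^sub>F n in sequentially. 1 / p n - (1 - p n) ^ k n * (real (s n) / 2) / 2 \<le> - ((l n)\<^sup>2 / 16) * real (k n)"
  using y_bounds k_bounds p_small eventually_basic eventually_l_gt[of 3] s0_times_p
proof eventually_elim
  case (elim n)
  have pn: "0 < p n" "p n < 1/4" using elim by auto
  \<comment> \<open>The second-order term 2 * k * p^2 in the exponent is at most 1 / 2, which costs
    a factor below 2.\<close>
  have "exp (- y n) / 2 \<le> (1 - p n) ^ k n"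
  proof -
    have "p n * y n \<le> p n * L n" using elim by (intro mult_left_mono) auto
    hence py: "2 * p n * y n \<le> 1/2" using elim by linarith
    have "real (k n) * (p n + 2 * (p n)\<^sup>2) = real (k n) * p n * (1 + 2 * p n)"
      by (simp add: algebra_simps power2_eq_square)
    also have "\<dots> \<le> y n * (1 + 2 * p n)" using elim by (intro mult_right_mono) auto
    also have "\<dots> \<le> y n + 1/2" using py by (simp add: algebra_simps)
    finally have 1: "real (k n) * (p n + 2 * (p n)\<^sup>2) \<le> y n + 1/2" .
    have "- p n - 2 * (p n)\<^sup>2 \<le> ln (1 - p n)"
      using pn by (intro ln_one_minus_pos_lower_bound) auto
    hence "real (k n) * (- p n - 2 * (p n)\<^sup>2) \<le> real (k n) * ln (1 - p n)"
      by (intro mult_left_mono) auto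
    hence "- y n - 1/2 \<le> real (k n) * ln (1 - p n)" using 1 by (simp add: algebra_simps)
    hence "exp (- y n - 1/2) \<le> exp (real (k n) * ln (1 - p n))" by simp
    also have "\<dots> = (1 - p n) ^ k n" using pn by (simp add: exp_of_nat_mult)
    finally have "exp (- y n) * exp (- 1/2) \<le> (1 - p n) ^ k n" by (simp add: exp_add[symmetric])
    moreover have "1/2 \<le> exp (- 1/2 :: real)" using exp_ge_add_one_self[of "- 1/2 :: real"] by simp
    hence "exp (- y n) * (1/2) \<le> exp (- y n) * exp (- 1/2)" by (intro mult_left_mono) auto
    ultimately show ?thesis by linarith
  qed
  moreover have "s0 n / 4 \<le> real (s n) / 2 / 2" using elim unfolding s_def by linarith
  ultimately have "exp (- y n) / 2 * (s0 n / 4) \<le> (1 - p n) ^ k n * (real (s n) / 2 / 2)"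
    using elim by (intro mult_mono) auto
  moreover have "exp (- y n) / 2 * (s0 n / 4) = (l n) ^ 3 / 8 / p n"
  proof -
    have "exp (- y n) = exp (- l n) * exp (ln (L n)) * exp (ln (l n)) ^ 5"
      by (simp add: y_def w_def exp_add[symmetric] exp_of_nat_mult[symmetric])
    also have "\<dots> = L n * l n ^ 5 / x n"
      using elim by (simp add: l_def exp_minus field_simps)
    finally show ?thesis
      using elim by (simp add: s0_def x_def field_simps eval_nat_numeral)
  qed
  moreover have "(l n)\<^sup>2 / 16 * real (k n) \<le> (l n) ^ 3 / 16 / p n"
  proof -
    have "(l n)\<^sup>2 / 16 * (real (k n) * p n) \<le> (l n)\<^sup>2 / 16 * l n"
      using elim by (intro mult_left_mono) auto
    thus ?thesis using pn by (simp add: field_simps eval_nat_numeral)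
  qed
  moreover have "1 / p n \<le> (l n) ^ 3 / 16 / p n"
  proof -
    have "3 ^ 3 \<le> (l n) ^ 3" using elim by (intro power_mono) auto
    thus ?thesis using pn by (intro divide_right_mono) auto
  qed
  moreover have "(l n) ^ 3 / 16 / p n + (l n) ^ 3 / 16 / p n = (l n) ^ 3 / 8 / p n" by (simp add: field_simps)
  ultimately show ?case by (simp add: field_simps)
qed

text \<open>Since (r - 1) * p / 2 \<ge> l, the non-edges contribute at most x^(-r). Against (e * n /
  r)^r this leaves the base e / (r * p) \<le> e / (2 * l), which tends to 0.\<close>

lemma independence_number_tendsto:
  "(\<lambda>n. real (n choose r n) * (1 - p n) ^ (r n choose 2)) \<longlonglongrightarrow> 0"
proof (rule tendsto_sandwich)
  show "\<forall>\<^sub>F n in sequentially. 0 \<le> real (n choose r n) * (1 - p n) ^ (r n choose 2)"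
    using p01 by (intro always_eventually allI mult_nonneg_nonneg) auto
  show "\<forall>\<^sub>F n in sequentially. real (n choose r n) * (1 - p n) ^ (r n choose 2) \<le> exp 1 / (2 * l n)"
    using r_bounds eventually_basic eventually_l_gt[of 2]
  proof eventually_elim
    case (elim n)
    have "(1 - p n) ^ (r n choose 2) \<le> exp (- p n) ^ (r n choose 2)"
      using exp_ge_add_one_self[of "- p n"] p01[of n] by (intro power_mono) auto
    also have "\<dots> = exp (- (p n * real (r n choose 2)))"
      by (simp add: exp_of_nat_mult[symmetric] mult_ac)
    also have "real (r n choose 2) = real (r n) * (real (r n) - 1) / 2"
      using elim by (simp add: choose_two real_of_nat_div of_nat_diff)
    also have "exp (- (p n * (real (r n) * (real (r n) - 1) / 2))) \<le> exp (real (r n) * (- l n))"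
    proof -
      have "real (r n) * (2 * l n) \<le> real (r n) * ((real (r n) - 1) * p n)"
        using elim by (intro mult_left_mono) auto
      thus ?thesis by (simp add: algebra_simps)
    qed
    also have "\<dots> = (1 / x n) ^ r n"
      using elim by (simp only: exp_of_nat_mult) (simp add: l_def exp_minus inverse_eq_divide)
    finally have "real (n choose r n) * (1 - p n) ^ (r n choose 2) \<le> (exp 1 * real n / real (r n)) ^ r n * (1 / x n) ^ r n"
      using elim p01[of n] by (intro mult_mono binomial_le_exp_power) auto
    also have "\<dots> = (exp 1 / (real (r n) * p n)) ^ r n"
      unfolding power_mult_distrib[symmetric] using elim by (simp add: x_def)
    also have "\<dots> \<le> (exp 1 / (2 * l n)) ^ r n"
      using elim by (intro power_mono divide_left_mono mult_pos_pos) auto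
    also have "\<dots> \<le> (exp 1 / (2 * l n)) ^ 1"
    proof (rule power_decreasing)
      show "exp 1 / (2 * l n) \<le> 1" using elim exp_le by simp
    qed (use elim in auto)
    finally show ?case by simp
  qed
  show "(\<lambda>n. exp 1 / (2 * l n)) \<longlonglongrightarrow> 0"
    by (rule filterlim_compose[OF _ l_at_top]) real_asymp
qed auto

text \<open>Per vertex of the set, the union bound costs e * n / s \<le> exp (1 + 3 * l), using L
  \<le> x = exp l, against a gain of exp (- l^2 / 32). The threshold 160 = 5 * 32 turns the gain
  into at least exp (- 5 * l).\<close>

lemma large_sets_tendsto:
  "(\<lambda>n. real (n choose s n) * exp (- ((l n)\<^sup>2 / 16) * (real (s n) - real (s n) / 2))) \<longlonglongrightarrow> 0"
proof (rule tendsto_sandwich)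
  show "\<forall>\<^sub>F n in sequentially. 0 \<le> real (n choose s n) * exp (- ((l n)\<^sup>2 / 16) * (real (s n) - real (s n) / 2))"
    by simp
  show "\<forall>\<^sub>F n in sequentially. real (n choose s n) * exp (- ((l n)\<^sup>2 / 16) * (real (s n) - real (s n) / 2)) \<le> exp (- l n)"
    using eventually_basic eventually_l_gt[of 160] s0_times_p
  proof eventually_elim
    case (elim n)
    have s: "s n \<ge> 1" "s0 n \<le> real (s n)" using elim unfolding s_def by linarith+
    have "real (n choose s n) * exp (- ((l n)\<^sup>2 / 16) * (real (s n) - real (s n) / 2)) \<le>
        (exp 1 * real n / real (s n)) ^ s n * exp (real (s n) * (- (l n)\<^sup>2 / 32))"
      using s by (intro mult_mono binomial_le_exp_power) auto
    also have "\<dots> = (exp 1 * (real n / real (s n)) * exp (- (l n)\<^sup>2 / 32)) ^ s n"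
      unfolding exp_of_nat_mult power_mult_distrib[symmetric] by simp
    also have "\<dots> \<le> exp (- l n) ^ s n"
    proof (rule power_mono)
      have "real n / real (s n) \<le> real n / s0 n"
        using s elim by (intro divide_left_mono mult_pos_pos) auto
      also have "\<dots> = L n * (l n)\<^sup>2" using elim by (simp add: s0_def)
      also have "\<dots> \<le> exp (l n) * (exp (l n))\<^sup>2"
      proof (intro mult_mono power_mono)
        show "L n \<le> exp (l n)" using elim by (simp add: l_def)
        show "l n \<le> exp (l n)" using exp_ge_add_one_self[of "l n"] by linarith
      qed (use elim in auto)
      also have "\<dots> = exp (3 * l n)" by (simp add: exp_double[symmetric] exp_add[symmetric])
      finally have "exp 1 * (real n / real (s n)) * exp (- (l n)\<^sup>2 / 32) \<le>
          exp 1 * exp (3 * l n) * exp (- (l n)\<^sup>2 / 32)"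
        by (intro mult_right_mono mult_left_mono) auto
      also have "\<dots> = exp (1 + 3 * l n - (l n)\<^sup>2 / 32)" by (simp add: exp_add[symmetric])
      also have "\<dots> \<le> exp (- l n)"
      proof -
        have "160 * l n \<le> l n * l n" using elim by (intro mult_right_mono) auto
        hence "1 + 3 * l n - (l n)\<^sup>2 / 32 \<le> - l n" using elim unfolding power2_eq_square by linarith
        thus ?thesis by simp
      qed
      finally show "exp 1 * (real n / real (s n)) * exp (- (l n)\<^sup>2 / 32) \<le> exp (- l n)" .
    qed auto
    also have "\<dots> \<le> exp (- l n) ^ 1"
      using s elim by (intro power_decreasing) auto
    finally show ?case by simp
  qed
  show "(\<lambda>n. exp (- l n)) \<longlonglongrightarrow> 0"
    by (rule filterlim_compose[OF _ l_at_top]) real_asymp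
qed auto

lemma aas_parameters:
  "aas p (\<lambda>n G. chromatic_number G \<le> paintability G \<and>
     paintability G \<le> Suc (K n) \<and> n \<le> chromatic_number G * r n)"
  unfolding aas_def
proof (rule tendsto_sandwich)
  let ?b = "\<lambda>n. 1 - (real (n choose r n) * (1 - p n) ^ (r n choose 2) +
    real (n choose s n) * exp (- ((l n)\<^sup>2 / 16) * (real (s n) - real (s n) / 2)) + 1 / real n)"
  have "?b \<longlonglongrightarrow> 1 - (0 + 0 + 0)"
    by (intro tendsto_intros independence_number_tendsto large_sets_tendsto lim_1_over_n)
  thus "?b \<longlonglongrightarrow> 1" by simp
  show "\<forall>\<^sub>F n in sequentially. ?b n \<le> measure_pmf.prob (gnp n (p n)) {G. chromatic_number G \<le> paintability G \<and>
      paintability G \<le> Suc (K n) \<and> n \<le> chromatic_number G * r n}"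
    using greedy_condition k_bounds p_small eventually_basic s0_times_p
  proof eventually_elim
    case (elim n)
    have h: "5 * s0 n * p n + 3 * L n \<le> real (h n)" unfolding h_def by linarith
    have sp: "0 < s0 n * p n" using elim by (intro mult_pos_pos) auto
    show ?case
    proof (rule prob_gnp_parameters_ge[where k = "k n" and h = "h n"])
      show "h n \<ge> 1"
      proof -
        have "real (h n) > 0" using h sp elim by linarith
        thus ?thesis by simp
      qed
      show "real (s n) / 2 > 0" using elim unfolding s_def by linarith
      show "3 * ln (real n) \<le> real (h n)" using h sp by (simp add: L_def)
      show "real n / real (k n) + real (2 * h n) * ln (real n) \<le> real (K n)"
        unfolding K_def by linarith
      fix t assume "t < s n"
      hence t: "real t \<le> s0 n" unfolding s_def by linarith
      have "(exp 1)\<^sup>2 \<le> (3::real)\<^sup>2" using exp_le by (intro power_mono) auto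
      hence "(exp 1)\<^sup>2 * real t * p n \<le> 9 * s0 n * p n"
        using t elim by (intro mult_mono) auto
      also have "\<dots> \<le> 2 * real (h n)" using h sp elim by (simp add: mult_ac)
      finally show "(exp 1)\<^sup>2 * real t * p n \<le> 2 * real (h n)" .
    qed (use elim in auto)
  qed
qed auto

section \<open>Error factors tending to 1\<close>

definition \<tau> :: "nat \<Rightarrow> real" where "\<tau> n = real (r n) * p n / (2 * l n)"

text \<open>Bounds K + 1 relative to x / w. The first summand stems from n / k with k * p \<ge> y -
  p, the second from the erasers for small sets, where the 2 absorbs the rounding in K and the
  successor.\<close>

definition \<kappa> :: "nat \<Rightarrow> real" where
  "\<kappa> n = w n / (y n - p n) + w n * (2 * real (h n) * L n + 2) / x n"

lemma \<tau>_tendsto: "\<tau> \<longlonglongrightarrow> 1"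
proof (rule tendsto_sandwich)
  show "\<forall>\<^sub>F n in sequentially. 1 \<le> \<tau> n"
    using r_bounds eventually_l_gt[of 0]
    by eventually_elim (simp add: \<tau>_def field_simps)
  show "\<forall>\<^sub>F n in sequentially. \<tau> n \<le> 1 + 1 / l n"
    using r_bounds eventually_l_gt[of 0] p_small
    by eventually_elim (simp add: \<tau>_def field_simps)
  have "(\<lambda>n. 1 + 1 / l n) \<longlonglongrightarrow> 1 + 0"
    by (intro tendsto_add tendsto_const filterlim_compose[OF _ l_at_top]) real_asymp
  thus "(\<lambda>n. 1 + 1 / l n) \<longlonglongrightarrow> 1" by simp
qed auto

lemma y_over_w: "(\<lambda>n. (y n - p n) / w n) \<longlonglongrightarrow> 1"
proof -
  have "(\<lambda>n. (5 * ln (l n) + p n) / w n) \<longlonglongrightarrow> 0"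
  proof (rule tendsto_sandwich)
    show "\<forall>\<^sub>F n in sequentially. 0 \<le> (5 * ln (l n) + p n) / w n"
      using w_bounds eventually_l_gt[of 1]
    proof eventually_elim
      case (elim n)
      thus ?case using p01[of n] by (intro divide_nonneg_nonneg add_nonneg_nonneg) auto
    qed
    show "\<forall>\<^sub>F n in sequentially. (5 * ln (l n) + p n) / w n \<le> 10 * (ln (l n) / l n) + 2 / l n"
      using w_bounds eventually_l_gt[of 1] p_small
    proof eventually_elim
      case (elim n)
      have "(5 * ln (l n) + p n) / w n \<le> (5 * ln (l n) + 1) / (l n / 2)"
        using elim p01[of n] by (intro frac_le) auto
      thus ?case using elim by (simp add: field_simps)
    qed
    have "(\<lambda>n. 10 * (ln (l n) / l n) + 2 / l n) \<longlonglongrightarrow> 10 * 0 + 0"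
      by (intro tendsto_intros ln_l_over_l filterlim_compose[OF _ l_at_top]) real_asymp
    thus "(\<lambda>n. 10 * (ln (l n) / l n) + 2 / l n) \<longlonglongrightarrow> 0" by simp
  qed auto
  hence "(\<lambda>n. 1 - (5 * ln (l n) + p n) / w n) \<longlonglongrightarrow> 1 - 0" by (intro tendsto_intros)
  moreover have "\<forall>\<^sub>F n in sequentially. 1 - (5 * ln (l n) + p n) / w n = (y n - p n) / w n"
    using w_bounds eventually_l_gt[of 1] by eventually_elim (simp add: y_def field_simps)
  ultimately show ?thesis by (simp add: tendsto_cong)
qed

text \<open>For small sets, 2 * h * L is of order x / l^2 + L^2. The first part is o(x / l) thanks
  to the factor l^2 in the denominator of s0, the second by \<open>L2_l_over_x\<close>.\<close>

lemma \<kappa>_tendsto: "\<kappa> \<longlonglongrightarrow> 1"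
proof -
  have "(\<lambda>n. inverse ((y n - p n) / w n)) \<longlonglongrightarrow> inverse 1"
    by (intro tendsto_inverse y_over_w) auto
  hence 1: "(\<lambda>n. w n / (y n - p n)) \<longlonglongrightarrow> 1" by simp
  have 2: "(\<lambda>n. w n * (2 * real (h n) * L n + 2) / x n) \<longlonglongrightarrow> 0"
  proof (rule tendsto_sandwich)
    show "\<forall>\<^sub>F n in sequentially. 0 \<le> w n * (2 * real (h n) * L n + 2) / x n"
      using w_bounds eventually_l_gt[of 1] eventually_basic
    proof eventually_elim
      case (elim n)
      thus ?case by (intro divide_nonneg_nonneg mult_nonneg_nonneg add_nonneg_nonneg) auto
    qed
    show "\<forall>\<^sub>F n in sequentially. w n * (2 * real (h n) * L n + 2) / x n \<le> 10 / l n + 10 * ((L n)\<^sup>2 * l n / x n)"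
      using w_bounds eventually_l_gt[of 1] s0_times_p eventually_basic
    proof eventually_elim
      case (elim n)
      have "0 \<le> 5 * s0 n * p n + 3 * L n" using elim by (intro add_nonneg_nonneg) auto
      hence "real (h n) \<le> 5 * s0 n * p n + 3 * L n + 1" unfolding h_def by linarith
      hence "real (h n) \<le> 5 * (x n / (L n * (l n)\<^sup>2)) + 3 * L n + 1" using elim by simp
      hence "2 * real (h n) * L n + 2 \<le> 2 * (5 * (x n / (L n * (l n)\<^sup>2)) + 3 * L n + 1) * L n + 2"
        using elim by (intro add_right_mono mult_right_mono) auto
      also have "\<dots> = 10 * x n / (l n)\<^sup>2 + 6 * (L n)\<^sup>2 + 2 * L n + 2"
        using elim by (simp add: field_simps power2_eq_square)
      also have "\<dots> \<le> 10 * x n / (l n)\<^sup>2 + 10 * (L n)\<^sup>2"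
      proof -
        have "1 * L n \<le> L n * L n" using elim by (intro mult_right_mono) auto
        thus ?thesis using elim unfolding power2_eq_square by linarith
      qed
      finally have "w n * (2 * real (h n) * L n + 2) \<le> l n * (10 * x n / (l n)\<^sup>2 + 10 * (L n)\<^sup>2)"
        using elim by (intro mult_mono) auto
      hence "w n * (2 * real (h n) * L n + 2) / x n \<le> l n * (10 * x n / (l n)\<^sup>2 + 10 * (L n)\<^sup>2) / x n"
        using elim by (intro divide_right_mono) auto
      also have "\<dots> = 10 / l n + 10 * ((L n)\<^sup>2 * l n / x n)"
        using elim by (simp add: field_simps power2_eq_square)
      finally show ?case .
    qed
    have "(\<lambda>n. 10 / l n + 10 * ((L n)\<^sup>2 * l n / x n)) \<longlonglongrightarrow> 0 + 10 * 0"
      by (intro tendsto_add tendsto_mult tendsto_const L2_l_over_x filterlim_compose[OF _ l_at_top]) real_asymp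
    thus "(\<lambda>n. 10 / l n + 10 * ((L n)\<^sup>2 * l n / x n)) \<longlonglongrightarrow> 0" by simp
  qed auto
  show ?thesis unfolding \<kappa>_def using tendsto_add[OF 1 2] by simp
qed

lemma K_le: "\<forall>\<^sub>F n in sequentially. real (Suc (K n)) \<le> \<kappa> n * (x n / w n)"
  using k_bounds y_bounds w_bounds p_small eventually_basic eventually_l_gt[of 1]
proof eventually_elim
  case (elim n)
  have "0 \<le> real n / real (k n) + real (2 * h n) * ln (real n)"
    using elim by (intro add_nonneg_nonneg mult_nonneg_nonneg) (auto simp: L_def)
  hence "real (Suc (K n)) \<le> real n / real (k n) + (2 * real (h n) * L n + 2)"
    unfolding K_def L_def by simp linarith
  also have "real n / real (k n) \<le> x n / (y n - p n)"
  proof -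
    have "real n / real (k n) = x n / (real (k n) * p n)" using elim by (simp add: x_def)
    also have "\<dots> \<le> x n / (y n - p n)" using elim by (intro divide_left_mono mult_pos_pos) auto
    finally show ?thesis .
  qed
  also have "x n / (y n - p n) + (2 * real (h n) * L n + 2) = \<kappa> n * (x n / w n)"
    using elim by (simp add: \<kappa>_def field_simps)
  finally show ?case by simp
qed

text \<open>In \<open>2 * l n / w n\<close> the \<open>w n = ln (np) - ln (ln n)\<close> comes from greedy independent sets inside the
  smallest sets to which they are applied; it is \<open>2 * C / (C - 1)\<close> if \<open>np = (ln n) powr C\<close>.\<close>

lemma aas_main:
  obtains \<rho> where "\<rho> \<longlonglongrightarrow> 1" "\<And>n. \<rho> n \<ge> 1"
    "aas p (\<lambda>n G. chromatic_number G \<le> paintability G \<and>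
       real (paintability G) \<le> \<rho> n * (x n / w n) \<and>
       real (paintability G) \<le> \<rho> n * (2 * l n / w n) * real (chromatic_number G) \<and>
       x n / (2 * l n) \<le> \<rho> n * real (chromatic_number G))"
proof -
  \<comment> \<open>The maxima with 1 make \<rho> dominate both error factors as well as their
    product.\<close>
  define \<rho> where "\<rho> n = max (\<kappa> n) 1 * max (\<tau> n) 1" for n
  have "(\<lambda>n. max (\<kappa> n) 1 * max (\<tau> n) 1) \<longlonglongrightarrow> max 1 1 * max 1 1"
    by (intro tendsto_intros \<kappa>_tendsto \<tau>_tendsto)
  hence lim: "\<rho> \<longlonglongrightarrow> 1" by (simp add: \<rho>_def[abs_def])
  have ge: "\<rho> n \<ge> 1" for n
    using mult_mono[of 1 "max (\<kappa> n) 1" 1 "max (\<tau> n) 1"] by (simp add: \<rho>_def)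
  show ?thesis
  proof (rule that[OF lim ge], rule aas_mono[OF aas_parameters])
    show "\<forall>\<^sub>F n in sequentially. \<forall>G :: nat graph. chromatic_number G \<le> paintability G \<and>
      paintability G \<le> Suc (K n) \<and> n \<le> chromatic_number G * r n \<longrightarrow>
      chromatic_number G \<le> paintability G \<and>
       real (paintability G) \<le> \<rho> n * (x n / w n) \<and>
       real (paintability G) \<le> \<rho> n * (2 * l n / w n) * real (chromatic_number G) \<and>
       x n / (2 * l n) \<le> \<rho> n * real (chromatic_number G)"
      using K_le w_bounds eventually_basic eventually_l_gt[of 1]
    proof (eventually_elim, intro allI impI)
      fix n and G :: "nat graph"
      assume A: "real (Suc (K n)) \<le> \<kappa> n * (x n / w n)" "l n / 2 \<le> w n \<and> w n \<le> l n"
        "n \<ge> 1 \<and> 0 < p n \<and> L n > 1 \<and> x n > 1 \<and> l n \<le> L n \<and> L n \<le> x n \<and>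
     0 < ln (L n) \<and> (2 + \<epsilon>) * ln (L n) \<le> l n" "1 < l n"
        and G: "chromatic_number G \<le> paintability G \<and>
          paintability G \<le> Suc (K n) \<and> n \<le> chromatic_number G * r n"
      let ?\<chi> = "real (chromatic_number G)"
      have xw: "x n / w n > 0" using A by simp
      have "real n \<le> ?\<chi> * real (r n)" using G by (simp flip: of_nat_mult)
      hence "real n * p n \<le> ?\<chi> * real (r n) * p n" using A by (intro mult_right_mono) auto
      hence "x n / (2 * l n) \<le> ?\<chi> * real (r n) * p n / (2 * l n)"
        using A unfolding x_def by (intro divide_right_mono) auto
      also have "\<dots> = \<tau> n * ?\<chi>" by (simp add: \<tau>_def)
      also have "\<dots> \<le> max (\<tau> n) 1 * ?\<chi>" by (intro mult_right_mono) auto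
      finally have 1: "x n / (2 * l n) \<le> max (\<tau> n) 1 * ?\<chi>" .
      have \<tau>\<rho>: "max (\<tau> n) 1 \<le> \<rho> n" and \<kappa>\<rho>: "max (\<kappa> n) 1 \<le> \<rho> n"
        using mult_right_mono[of 1 "max (\<kappa> n) 1" "max (\<tau> n) 1"]
          mult_left_mono[of 1 "max (\<tau> n) 1" "max (\<kappa> n) 1"] by (auto simp: \<rho>_def)
      have "real (paintability G) \<le> real (Suc (K n))" using G by simp
      also have "\<dots> \<le> max (\<kappa> n) 1 * (x n / w n)"
        using A(1) xw by (intro order_trans[OF A(1)] mult_right_mono) auto
      finally have 2: "real (paintability G) \<le> max (\<kappa> n) 1 * (x n / w n)" .
      also have "\<dots> \<le> \<rho> n * (x n / w n)" using \<kappa>\<rho> xw by (intro mult_right_mono) auto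
      finally have 3: "real (paintability G) \<le> \<rho> n * (x n / w n)" .
      have "x n / w n = (2 * l n / w n) * (x n / (2 * l n))" using A by simp
      also have "\<dots> \<le> (2 * l n / w n) * (max (\<tau> n) 1 * ?\<chi>)"
        using 1 A by (intro mult_left_mono) auto
      finally have "max (\<kappa> n) 1 * (x n / w n) \<le> max (\<kappa> n) 1 * ((2 * l n / w n) * (max (\<tau> n) 1 * ?\<chi>))"
        by (intro mult_left_mono) auto
      also have "\<dots> = \<rho> n * (2 * l n / w n) * ?\<chi>" by (simp add: \<rho>_def)
      finally have 4: "real (paintability G) \<le> \<rho> n * (2 * l n / w n) * ?\<chi>" using 2 by linarith
      have "max (\<tau> n) 1 * ?\<chi> \<le> \<rho> n * ?\<chi>" using \<tau>\<rho> by (intro mult_right_mono) auto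
      with 1 have "x n / (2 * l n) \<le> \<rho> n * ?\<chi>" by linarith
      with G 3 4 show "chromatic_number G \<le> paintability G \<and>
       real (paintability G) \<le> \<rho> n * (x n / w n) \<and>
       real (paintability G) \<le> \<rho> n * (2 * l n / w n) * ?\<chi> \<and>
       x n / (2 * l n) \<le> \<rho> n * ?\<chi>" by simp
    qed
  qed
qed

end

section \<open>Deduction of the constants for the ranges of C\<close>

theorem theorem2:
  fixes \<epsilon> :: real and p :: "nat \<Rightarrow> real"
  assumes "\<epsilon> > 0"
    and "\<And>n. p n \<in> {0..1}"
    and "\<forall>\<^sub>F n in sequentially. ln (real n) powr (2 + \<epsilon>) / real n \<le> p n"
    and "p \<in> O(\<lambda>n. ln (ln (real n)) powr (1/3) * (ln (real n))\<^sup>2 * real n powr (-1/3))"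
  shows "aas_theta p (\<lambda>n G. real (paintability G)) (\<lambda>n G. real n * p n / ln (real n * p n))
    \<and> aas_theta p (\<lambda>n G. real (paintability G)) (\<lambda>n G. real (chromatic_number G))
    \<and> (\<forall>(C :: nat \<Rightarrow> real) (\<delta> :: nat \<Rightarrow> real).
         \<delta> \<longlonglongrightarrow> 0 \<longrightarrow>
         (\<forall>\<^sub>F n in sequentially. real n * p n = ln (real n) powr (C n + \<delta> n)) \<longrightarrow>
           aas p (\<lambda>n G. chromatic_number G \<le> paintability G)
         \<and> (filterlim C at_top sequentially \<longrightarrow>
              aas_asymp_le p (\<lambda>n G. real (paintability G))
                (\<lambda>n G. 2 * real (chromatic_number G)))
         \<and> ((\<forall>\<^sub>F n in sequentially. 4 \<le> C n) \<longrightarrow>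
              aas_asymp_le p (\<lambda>n G. real (paintability G))
                (\<lambda>n G. 2 * C n / (C n - 2) * real (chromatic_number G)))
         \<and> ((\<forall>\<^sub>F n in sequentially. 2 < C n \<and> C n < 4) \<longrightarrow>
              aas_asymp_le p (\<lambda>n G. real (paintability G))
                (\<lambda>n G. 4 * real (chromatic_number G))))"
proof -
  interpret sparse_regime \<epsilon> p by unfold_locales (fact assms)+
  obtain \<rho> where \<rho>: "\<rho> \<longlonglongrightarrow> 1" "\<And>n. \<rho> n \<ge> 1" and
    main: "aas p (\<lambda>n G. chromatic_number G \<le> paintability G \<and>
       real (paintability G) \<le> \<rho> n * (x n / w n) \<and>
       real (paintability G) \<le> \<rho> n * (2 * l n / w n) * real (chromatic_number G) \<and>
       x n / (2 * l n) \<le> \<rho> n * real (chromatic_number G))"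
    using aas_main by blast
  have \<rho>2: "\<forall>\<^sub>F n in sequentially. \<rho> n < 2" using order_tendstoD(2)[OF \<rho>(1), of 2] by simp
  have \<rho>1: "(\<lambda>n. \<rho> n - 1) \<longlonglongrightarrow> 0" using tendsto_diff[OF \<rho>(1) tendsto_const, of 1] by simp
  have lw: "\<forall>\<^sub>F n in sequentially. l n / w n \<le> 2 \<and> 0 \<le> l n / w n \<and> 0 < w n"
    using w_bounds eventually_l_gt[of 0] by eventually_elim (simp add: field_simps)
  have theta1: "aas_theta p (\<lambda>n G. real (paintability G)) (\<lambda>n G. real n * p n / ln (real n * p n))"
    unfolding aas_theta_def
  \<comment> \<open>Eventually \<rho> < 2. Then x / (2 * l) \<le> 2 * paintability gives 1 / 4, and
    w \<ge> l / 2 gives the factor 4.\<close>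
  proof (rule exI[of _ "1/4"], intro exI[of _ "4::real"] conjI aas_mono[OF main])
    show "\<forall>\<^sub>F n in sequentially. \<forall>G :: nat graph. chromatic_number G \<le> paintability G \<and>
       real (paintability G) \<le> \<rho> n * (x n / w n) \<and>
       real (paintability G) \<le> \<rho> n * (2 * l n / w n) * real (chromatic_number G) \<and>
       x n / (2 * l n) \<le> \<rho> n * real (chromatic_number G) \<longrightarrow>
       1 / 4 * (real n * p n / ln (real n * p n)) \<le> real (paintability G) \<and>
       real (paintability G) \<le> 4 * (real n * p n / ln (real n * p n))"
      using \<rho>2 w_bounds eventually_l_gt[of 0] eventually_basic
    proof (eventually_elim, intro allI impI)
      fix n and G :: "nat graph"
      assume A: "\<rho> n < 2" "l n / 2 \<le> w n \<and> w n \<le> l n" "0 < l n"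
        "n \<ge> 1 \<and> 0 < p n \<and> L n > 1 \<and> x n > 1 \<and> l n \<le> L n \<and> L n \<le> x n \<and>
           0 < ln (L n) \<and> (2 + \<epsilon>) * ln (L n) \<le> l n"
        and G: "chromatic_number G \<le> paintability G \<and>
          real (paintability G) \<le> \<rho> n * (x n / w n) \<and>
          real (paintability G) \<le> \<rho> n * (2 * l n / w n) * real (chromatic_number G) \<and>
          x n / (2 * l n) \<le> \<rho> n * real (chromatic_number G)"
      have "\<rho> n * real (chromatic_number G) \<le> 2 * real (paintability G)"
        using A(1) G \<rho>(2)[of n] by (intro mult_mono) auto
      hence "x n / (2 * l n) \<le> 2 * real (paintability G)" using G by linarith
      hence 1: "1 / 4 * (x n / l n) \<le> real (paintability G)" using A by (simp add: field_simps)
      have "\<rho> n * (x n / w n) \<le> 2 * (x n / (l n / 2))"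
        using A \<rho>(2)[of n] by (intro mult_mono divide_left_mono mult_pos_pos) auto
      hence "real (paintability G) \<le> 4 * (x n / l n)" using G by simp
      with 1 show "1 / 4 * (real n * p n / ln (real n * p n)) \<le> real (paintability G) \<and>
          real (paintability G) \<le> 4 * (real n * p n / ln (real n * p n))"
        by (simp add: l_def x_def)
    qed
  qed auto
  have asymp: "aas_asymp_le p (\<lambda>n G. real (paintability G)) (\<lambda>n G. c n * real (chromatic_number G))"
    if "\<eta> \<longlonglongrightarrow> 0" "\<forall>\<^sub>F n in sequentially. \<rho> n * (2 * l n / w n) \<le> (1 + \<eta> n) * c n" for \<eta> c
    unfolding aas_asymp_le_def
  proof (intro exI[of _ \<eta>] conjI aas_mono[OF main] that(1))
    show "\<forall>\<^sub>F n in sequentially. \<forall>G :: nat graph. chromatic_number G \<le> paintability G \<and>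
       real (paintability G) \<le> \<rho> n * (x n / w n) \<and>
       real (paintability G) \<le> \<rho> n * (2 * l n / w n) * real (chromatic_number G) \<and>
       x n / (2 * l n) \<le> \<rho> n * real (chromatic_number G) \<longrightarrow>
       real (paintability G) \<le> (1 + \<eta> n) * (c n * real (chromatic_number G))"
      using that(2)
    proof (eventually_elim, intro allI impI)
      fix n and G :: "nat graph"
      assume A: "\<rho> n * (2 * l n / w n) \<le> (1 + \<eta> n) * c n"
        and G: "chromatic_number G \<le> paintability G \<and>
          real (paintability G) \<le> \<rho> n * (x n / w n) \<and>
          real (paintability G) \<le> \<rho> n * (2 * l n / w n) * real (chromatic_number G) \<and>
          x n / (2 * l n) \<le> \<rho> n * real (chromatic_number G)"
      have "real (paintability G) \<le> \<rho> n * (2 * l n / w n) * real (chromatic_number G)" using G by simp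
      also have "\<dots> \<le> (1 + \<eta> n) * c n * real (chromatic_number G)"
        using A by (intro mult_right_mono) auto
      finally show "real (paintability G) \<le> (1 + \<eta> n) * (c n * real (chromatic_number G))"
        by (simp add: mult.assoc)
    qed
  qed
  \<comment> \<open>The error term is \<rho> - 1, since l / w \<le> 2 already gives 2 * l / w \<le>
    4.\<close>
  have four: "aas_asymp_le p (\<lambda>n G. real (paintability G)) (\<lambda>n G. 4 * real (chromatic_number G))"
  proof (rule asymp[OF \<rho>1])
    show "\<forall>\<^sub>F n in sequentially. \<rho> n * (2 * l n / w n) \<le> (1 + (\<rho> n - 1)) * 4"
      using lw
    proof eventually_elim
      case (elim n)
      hence "\<rho> n * (2 * l n / w n) \<le> \<rho> n * 4" using \<rho>(2)[of n] by (intro mult_left_mono) auto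
      thus ?case by simp
    qed
  qed
  have theta2: "aas_theta p (\<lambda>n G. real (paintability G)) (\<lambda>n G. real (chromatic_number G))"
    unfolding aas_theta_def
  proof (rule exI[of _ 1], intro exI[of _ "8::real"] conjI aas_mono[OF main])
    show "\<forall>\<^sub>F n in sequentially. \<forall>G :: nat graph. chromatic_number G \<le> paintability G \<and>
       real (paintability G) \<le> \<rho> n * (x n / w n) \<and>
       real (paintability G) \<le> \<rho> n * (2 * l n / w n) * real (chromatic_number G) \<and>
       x n / (2 * l n) \<le> \<rho> n * real (chromatic_number G) \<longrightarrow>
       1 * real (chromatic_number G) \<le> real (paintability G) \<and>
       real (paintability G) \<le> 8 * real (chromatic_number G)"
      using \<rho>2 lw
    proof (eventually_elim, intro allI impI)
      fix n and G :: "nat graph"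
      assume A: "\<rho> n < 2" "l n / w n \<le> 2 \<and> 0 \<le> l n / w n \<and> 0 < w n"
        and G: "chromatic_number G \<le> paintability G \<and>
          real (paintability G) \<le> \<rho> n * (x n / w n) \<and>
          real (paintability G) \<le> \<rho> n * (2 * l n / w n) * real (chromatic_number G) \<and>
          x n / (2 * l n) \<le> \<rho> n * real (chromatic_number G)"
      have "\<rho> n * (2 * l n / w n) \<le> 2 * 4" using A \<rho>(2)[of n] by (intro mult_mono) auto
      hence "\<rho> n * (2 * l n / w n) * real (chromatic_number G) \<le> 8 * real (chromatic_number G)"
        by (intro mult_right_mono) auto
      thus "1 * real (chromatic_number G) \<le> real (paintability G) \<and>
          real (paintability G) \<le> 8 * real (chromatic_number G)"
        using G by linarith
    qed
  qed auto
  have "aas p (\<lambda>n G. chromatic_number G \<le> paintability G) \<and>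
      (filterlim C at_top sequentially \<longrightarrow>
         aas_asymp_le p (\<lambda>n G. real (paintability G)) (\<lambda>n G. 2 * real (chromatic_number G))) \<and>
      ((\<forall>\<^sub>F n in sequentially. 4 \<le> C n) \<longrightarrow>
         aas_asymp_le p (\<lambda>n G. real (paintability G))
           (\<lambda>n G. 2 * C n / (C n - 2) * real (chromatic_number G))) \<and>
      ((\<forall>\<^sub>F n in sequentially. 2 < C n \<and> C n < 4) \<longrightarrow>
         aas_asymp_le p (\<lambda>n G. real (paintability G)) (\<lambda>n G. 4 * real (chromatic_number G)))"
    if \<delta>: "\<delta> \<longlonglongrightarrow> 0" and C: "\<forall>\<^sub>F n in sequentially. real n * p n = ln (real n) powr (C n + \<delta> n)"
    for C \<delta> :: "nat \<Rightarrow> real"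
  proof (intro conjI impI)
    have l: "\<forall>\<^sub>F n in sequentially. l n = (C n + \<delta> n) * ln (L n)"
      using C eventually_basic by eventually_elim (simp add: l_def x_def L_def ln_powr)
    have \<delta>1: "\<forall>\<^sub>F n in sequentially. -1 < \<delta> n" using order_tendstoD(1)[OF \<delta>, of "-1"] by simp
    show "aas p (\<lambda>n G. chromatic_number G \<le> paintability G)"
      by (rule aas_mono[OF main]) simp
    show "aas_asymp_le p (\<lambda>n G. real (paintability G)) (\<lambda>n G. 2 * real (chromatic_number G))"
      if "filterlim C at_top sequentially"
    proof (rule asymp)
      have "filterlim (\<lambda>n. \<delta> n + C n) at_top sequentially"
        by (rule filterlim_tendsto_add_at_top[OF \<delta> that])
      hence "(\<lambda>n. inverse (\<delta> n + C n)) \<longlonglongrightarrow> 0" by (rule tendsto_inverse_0_at_top)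
      \<comment> \<open>With l = (C + \<delta>) * ln L, the ratio l / w is exactly 1 / (1 - 1 / (C +
        \<delta>)), and the error term is read off from it.\<close>
      hence "(\<lambda>n. \<rho> n * inverse (1 - inverse (\<delta> n + C n)) - 1) \<longlonglongrightarrow> 1 * inverse (1 - 0) - 1"
        by (intro tendsto_intros \<rho>(1)) auto
      thus "(\<lambda>n. \<rho> n * inverse (1 - inverse (\<delta> n + C n)) - 1) \<longlonglongrightarrow> 0" by simp
      show "\<forall>\<^sub>F n in sequentially. \<rho> n * (2 * l n / w n) \<le>
          (1 + (\<rho> n * inverse (1 - inverse (\<delta> n + C n)) - 1)) * 2"
        using l eventually_l_gt[of 0] eventually_basic
      proof eventually_elim
        case (elim n)
        have nz: "\<delta> n + C n \<noteq> 0" using elim by (auto simp: add.commute)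
        have "w n = (\<delta> n + C n - 1) * ln (L n)" using elim by (simp add: w_def algebra_simps)
        hence "l n / w n = ((\<delta> n + C n) * ln (L n)) / ((\<delta> n + C n - 1) * ln (L n))"
          using elim by (simp add: add.commute)
        also have "\<dots> = (\<delta> n + C n) / (\<delta> n + C n - 1)" using elim by simp
        also have "\<dots> = inverse (1 - inverse (\<delta> n + C n))" using nz by (simp add: field_simps)
        finally have "l n / w n = inverse (1 - inverse (\<delta> n + C n))" .
        hence "\<rho> n * (2 * (l n / w n)) = \<rho> n * inverse (1 - inverse (\<delta> n + C n)) * 2" by simp
        thus ?case by simp
      qed
    qed
    show "aas_asymp_le p (\<lambda>n G. real (paintability G))
        (\<lambda>n G. 2 * C n / (C n - 2) * real (chromatic_number G))"
      if "\<forall>\<^sub>F n in sequentially. 4 \<le> C n"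
    proof (rule asymp[OF \<rho>1])
      show "\<forall>\<^sub>F n in sequentially. \<rho> n * (2 * l n / w n) \<le> (1 + (\<rho> n - 1)) * (2 * C n / (C n - 2))"
        using l that lw \<delta>1 eventually_basic
      proof eventually_elim
        case (elim n)
        \<comment> \<open>The true ratio (C + \<delta>) / (C + \<delta> - 1) is at most C / (C - 2)
          as soon as C \<le> 2 * (C + \<delta>), which C \<ge> 4 and \<delta> > -1 ensure. So
          \<delta> leaves no trace in the error term.\<close>
        have "C n * ln (L n) \<le> 2 * (C n + \<delta> n) * ln (L n)"
          using elim by (intro mult_right_mono) auto
        hence "l n * (C n - 2) \<le> C n * w n" using elim by (simp add: w_def algebra_simps)
        hence "l n / w n \<le> C n / (C n - 2)" using elim by (simp add: field_simps)
        hence "\<rho> n * (2 * (l n / w n)) \<le> \<rho> n * (2 * (C n / (C n - 2)))"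
          using \<rho>(2)[of n] by (intro mult_left_mono) auto
        thus ?case by simp
      qed
    qed
    show "aas_asymp_le p (\<lambda>n G. real (paintability G)) (\<lambda>n G. 4 * real (chromatic_number G))"
      by (rule four)
  qed
  with theta1 theta2 show ?thesis by blast
qed

end
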